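(* Let $n\ge1$ be an integer. The link of the $A_n$ singularity $(L_{A_n},\xi_0=\ker\alpha_0)$ and the lens space $(L(n+1,n),\xi_{std}=\ker\lambda_{std})$ are contactomorphic.
   Context: $L_{A_n}=\{z\in\mathbb{C}^3: z_0^{n+1}+2z_1z_2=0\}\cap S^5$, where $S^5\subset\mathbb{C}^3$ is the unit sphere, and $\alpha_0=\frac i2\sum_{j=0}^2(z_jd\bar z_j-\bar z_jdz_j)|_{L_{A_n}}$; its kernel is $\xi_0=TL_{A_n}\cap J_0(TL_{A_n})$, with $J_0$ the standard complex structure on $\mathbb{C}^3$. $L(n+1,n)=S^3/\big((u,v)\sim(e^{2\pi i/(n+1)}u,e^{2\pi ni/(n+1)}v)\big)$, where $S^3\subset\mathbb{C}^2$ is the unit sphere, and $\lambda_{std}$ is the contact form on $L(n+1,n)$ induced by the invariant form $\frac i2(u\,d\bar u-\bar u\,du+v\,d\bar v-\bar v\,dv)$ on $S^3$. Two contact manifolds $(M_0,\xi_0),(M_1,\xi_1)$ are contactomorphic if there is a diffeomorphism $\psi:M_0\to M_1$ with $\psi_*\xi_0=\xi_1$. *)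

theory Defs
  imports "HOL-Analysis.Analysis"
begin

section \<open>Smooth maps on subsets of Euclidean space\<close>

primrec Ck_on :: "nat \<Rightarrow> ('a::euclidean_space \<Rightarrow> 'b::real_normed_vector) \<Rightarrow> 'a set \<Rightarrow> bool" where
  "Ck_on 0 f S \<longleftrightarrow> continuous_on S f"
| "Ck_on (Suc k) f S \<longleftrightarrow>
     (\<forall>x\<in>S. f differentiable (at x)) \<and>
     (\<forall>v. Ck_on k (\<lambda>x. frechet_derivative f (at x) v) S)"

text \<open>On an arbitrary subset, smoothness means local extendability to a map that is smooth on an
  open set.  On an open set this is ordinary \<open>C\<^sup>\<infinity>\<close> smoothness.\<close>

definition smooth_on :: "'a::euclidean_space set \<Rightarrow> ('a \<Rightarrow> 'b::real_normed_vector) \<Rightarrow> bool" where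
  "smooth_on S f \<longleftrightarrow>
     (\<forall>x\<in>S. \<exists>W g. open W \<and> x \<in> W \<and> (\<forall>k. Ck_on k g W) \<and> (\<forall>y\<in>S \<inter> W. g y = f y))"


section \<open>Manifolds given by atlases\<close>

text \<open>A chart is a pair of a domain and a coordinate map (only its values on the domain matter).
  A manifold is a pair of a point set and an atlas.  The topology is the one determined by the
  atlas.\<close>

type_synonym ('a, 'e) chart = "'a set \<times> ('a \<Rightarrow> 'e)"
type_synonym ('a, 'e) manifold = "'a set \<times> ('a, 'e) chart set"

abbreviation points :: "('a, 'e) manifold \<Rightarrow> 'a set" where
  "points M \<equiv> fst M"

abbreviation atlas :: "('a, 'e) manifold \<Rightarrow> ('a, 'e) chart set" where
  "atlas M \<equiv> snd M"

abbreviation dom_chart :: "('a, 'e) chart \<Rightarrow> 'a set" where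
  "dom_chart c \<equiv> fst c"

abbreviation coord :: "('a, 'e) chart \<Rightarrow> 'a \<Rightarrow> 'e" where
  "coord c \<equiv> snd c"

definition param :: "('a, 'e) chart \<Rightarrow> 'e \<Rightarrow> 'a" where
  "param c = inv_into (dom_chart c) (coord c)"

definition charts_at :: "('a, 'e) manifold \<Rightarrow> 'a \<Rightarrow> ('a, 'e) chart set" where
  "charts_at M p = {c \<in> atlas M. p \<in> dom_chart c}"

definition smooth_map ::
  "('a, 'e::euclidean_space) manifold \<Rightarrow> ('b, 'f::euclidean_space) manifold \<Rightarrow> ('a \<Rightarrow> 'b) \<Rightarrow> bool" where
  "smooth_map M N f \<longleftrightarrow> f ` points M \<subseteq> points N \<and>
     (\<forall>p\<in>points M. \<exists>c\<in>charts_at M p. \<exists>d\<in>charts_at N (f p). \<exists>W.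
        open W \<and> coord c p \<in> W \<and> W \<subseteq> coord c ` dom_chart c \<and>
        f ` param c ` W \<subseteq> dom_chart d \<and>
        smooth_on W (\<lambda>x. coord d (f (param c x))))"

definition diffeomorphism ::
  "('a, 'e::euclidean_space) manifold \<Rightarrow> ('b, 'f::euclidean_space) manifold \<Rightarrow> ('a \<Rightarrow> 'b) \<Rightarrow> bool" where
  "diffeomorphism M N f \<longleftrightarrow> bij_betw f (points M) (points N) \<and>
     smooth_map M N f \<and> smooth_map N M (inv_into (points M) f)"


section \<open>Tangent vectors\<close>

text \<open>A tangent vector at \<open>p\<close> is the family of its coordinate representations, one for each
  chart around \<open>p\<close>, related by the derivatives of the coordinate changes.  Its value at charts
  not containing \<open>p\<close> is normalised to \<open>0\<close>.\<close>

type_synonym ('a, 'e) tangent = "('a, 'e) chart \<Rightarrow> 'e"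

definition tangent_space ::
  "('a, 'e::euclidean_space) manifold \<Rightarrow> 'a \<Rightarrow> ('a, 'e) tangent set" where
  "tangent_space M p = {v.
     (\<forall>c\<in>charts_at M p. \<forall>d\<in>charts_at M p.
        v d = frechet_derivative (\<lambda>x. coord d (param c x)) (at (coord c p)) (v c)) \<and>
     (\<forall>c. c \<notin> charts_at M p \<longrightarrow> v c = 0)}"

text \<open>The differential at \<open>p\<close> of a vector-valued function, applied to a tangent vector;
  by the chain rule the chosen chart is irrelevant.\<close>

definition fun_differential ::
  "('a, 'e::euclidean_space) manifold \<Rightarrow> ('a \<Rightarrow> 'b::real_normed_vector) \<Rightarrow> 'a \<Rightarrow> ('a, 'e) tangent \<Rightarrow> 'b" where
  "fun_differential M f p v =
     (let c = (SOME c. c \<in> charts_at M p)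
      in frechet_derivative (\<lambda>x. f (param c x)) (at (coord c p)) (v c))"

definition differential ::
  "('a, 'e::euclidean_space) manifold \<Rightarrow> ('b, 'f::euclidean_space) manifold \<Rightarrow> ('a \<Rightarrow> 'b) \<Rightarrow> 'a
     \<Rightarrow> ('a, 'e) tangent \<Rightarrow> ('b, 'f) tangent" where
  "differential M N f p v =
     (\<lambda>d. if d \<in> charts_at N (f p) then fun_differential M (\<lambda>q. coord d (f q)) p v else 0)"


section \<open>Contactomorphisms\<close>

definition form_kernel ::
  "('a, 'e::euclidean_space) manifold \<Rightarrow> ('a \<Rightarrow> ('a, 'e) tangent \<Rightarrow> 'k::zero) \<Rightarrow> 'a \<Rightarrow> ('a, 'e) tangent set" where
  "form_kernel M \<alpha> p = {v \<in> tangent_space M p. \<alpha> p v = 0}"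

definition contactomorphic ::
  "('a, 'e::euclidean_space) manifold \<Rightarrow> ('a \<Rightarrow> ('a, 'e) tangent set) \<Rightarrow>
   ('b, 'f::euclidean_space) manifold \<Rightarrow> ('b \<Rightarrow> ('b, 'f) tangent set) \<Rightarrow> bool" where
  "contactomorphic M \<xi> N \<eta> \<longleftrightarrow>
     (\<exists>\<psi>. diffeomorphism M N \<psi> \<and> (\<forall>p\<in>points M. differential M N \<psi> p ` \<xi> p = \<eta> (\<psi> p)))"


section \<open>Submanifolds of Euclidean space and quotients\<close>

text \<open>The charts of a subset \<open>X\<close> of Euclidean space are all diffeomorphisms from relatively open
  subsets of \<open>X\<close> onto open subsets of the model space; \<open>X\<close> is an embedded submanifold
  if and only if these cover \<open>X\<close>.\<close>

definition submanifold :: "'a::euclidean_space set \<Rightarrow> ('a, 'e::euclidean_space) manifold" where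
  "submanifold X = (X, {c. openin (top_of_set X) (dom_chart c) \<and>
     inj_on (coord c) (dom_chart c) \<and> open (coord c ` dom_chart c) \<and>
     smooth_on (dom_chart c) (coord c) \<and> smooth_on (coord c ` dom_chart c) (param c)})"

definition quotient_proj :: "('a \<times> 'a) set \<Rightarrow> 'a \<Rightarrow> 'a set" where
  "quotient_proj r p = r `` {p}"

text \<open>The smooth structure on the quotient for which the projection is a local diffeomorphism:
  its charts are those of \<open>M\<close> on whose domain the projection is injective, pushed down.  For the
  orbit relation of a free action of a finite group by diffeomorphisms this is a smooth atlas.\<close>

definition quotient_manifold ::
  "('a \<times> 'a) set \<Rightarrow> ('a, 'e::euclidean_space) manifold \<Rightarrow> ('a set, 'e) manifold" where
  "quotient_manifold r M = (points M // r,
     {(quotient_proj r ` dom_chart c,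
       \<lambda>q. coord c (inv_into (dom_chart c) (quotient_proj r) q)) | c.
      c \<in> atlas M \<and> inj_on (quotient_proj r) (dom_chart c)})"

text \<open>The form on the quotient whose pullback under the projection is the given invariant form
  \<open>\<omega>\<close>.\<close>

definition induced_form ::
  "('a \<times> 'a) set \<Rightarrow> ('a, 'e::euclidean_space) manifold \<Rightarrow> ('a \<Rightarrow> ('a, 'e) tangent \<Rightarrow> 'k)
     \<Rightarrow> 'a set \<Rightarrow> ('a set, 'e) tangent \<Rightarrow> 'k" where
  "induced_form r M \<omega> q w =
     (THE t. \<exists>p\<in>points M. \<exists>v\<in>tangent_space M p. quotient_proj r p = q \<and>
        differential M (quotient_manifold r M) (quotient_proj r) p v = w \<and> \<omega> p v = t)"


section \<open>The link of the \<open>A\<^sub>n\<close> singularity and the lens space\<close>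

text \<open>The restriction of \<open>(i/2) \<Sum>\<^sub>j (z\<^sub>j dz\<^sub>j\<^sup>* - z\<^sub>j\<^sup>* dz\<^sub>j)\<close> (where \<open>\<^sup>*\<close> is conjugation) to a submanifold
  of complex space; it takes real values, regarded here as complex numbers.\<close>

definition std_form ::
  "(complex^'n, 'e::euclidean_space) manifold \<Rightarrow> complex^'n \<Rightarrow> (complex^'n, 'e) tangent \<Rightarrow> complex" where
  "std_form M z v = \<i> / 2 * (\<Sum>j\<in>UNIV.
     z $ j * fun_differential M (\<lambda>y. cnj (y $ j)) z v -
     cnj (z $ j) * fun_differential M (\<lambda>y. y $ j) z v)"

text \<open>The coordinates \<open>z\<^sub>0, z\<^sub>1, z\<^sub>2\<close> are the components with index \<open>1, 2, 3\<close>.\<close>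

definition link_A :: "nat \<Rightarrow> (complex^3, real^3) manifold" where
  "link_A n = submanifold ({z. (z $ 1) ^ (n + 1) + 2 * z $ 2 * z $ 3 = 0} \<inter> sphere 0 1)"

definition link_contact_structure ::
  "nat \<Rightarrow> complex^3 \<Rightarrow> (complex^3, real^3) tangent set" where
  "link_contact_structure n = form_kernel (link_A n) (std_form (link_A n))"

definition sphere3 :: "(complex^2, real^3) manifold" where
  "sphere3 = submanifold (sphere 0 1)"

definition lens_rotation :: "nat \<Rightarrow> nat \<Rightarrow> complex^2 \<Rightarrow> complex^2" where
  "lens_rotation p q z =
     vector [exp (2 * of_real pi * \<i> / of_nat p) * z $ 1,
             exp (2 * of_real pi * of_nat q * \<i> / of_nat p) * z $ 2]"

text \<open>The rotation has finite order, so its forward orbits are the classes of the equivalence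
  relation it generates.\<close>

definition lens_rel :: "nat \<Rightarrow> nat \<Rightarrow> ((complex^2) \<times> (complex^2)) set" where
  "lens_rel p q = {(z, (lens_rotation p q ^^ k) z) | z k. z \<in> points sphere3}"

definition lens_space :: "nat \<Rightarrow> nat \<Rightarrow> ((complex^2) set, real^3) manifold" where
  "lens_space p q = quotient_manifold (lens_rel p q) sphere3"

definition lens_contact_form ::
  "nat \<Rightarrow> nat \<Rightarrow> (complex^2) set \<Rightarrow> ((complex^2) set, real^3) tangent \<Rightarrow> complex" where
  "lens_contact_form p q = induced_form (lens_rel p q) sphere3 (std_form sphere3)"

definition lens_contact_structure ::
  "nat \<Rightarrow> nat \<Rightarrow> (complex^2) set \<Rightarrow> ((complex^2) set, real^3) tangent set" where
  "lens_contact_structure p q = form_kernel (lens_space p q) (lens_contact_form p q)"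

end

theory Submission
  imports Defs "HOL-Complex_Analysis.Cauchy_Integral_Formula"
begin

text \<open>The monomial map \<open>(u, v) \<mapsto> (u v, u\<^sup>n\<^sup>+\<^sup>1, v\<^sup>n\<^sup>+\<^sup>1)\<close> identifies the quotient of \<open>\<complex>\<^sup>2\<close> by the cyclic group
  with the \<open>A\<^sub>n\<close> singularity, up to constants, but does not send \<open>S\<^sup>3\<close> to \<open>S\<^sup>5\<close>.  Both contact
  structures are invariant under the torus acting on the arguments of \<open>u\<close> and \<open>v\<close>, so no isotopy
  argument is needed: it suffices to rescale the coordinates by positive functions of the moduli such
  that the two coefficients of the pulled back form are in the ratio \<open>\<bar>u\<bar>\<^sup>2 : \<bar>v\<bar>\<^sup>2\<close>.

  Write \<open>p, q\<^sub>1, q\<^sub>2\<close> for the squared moduli of a point of the link, so that \<open>p + q\<^sub>1 + q\<^sub>2 = 1\<close> and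
  \<open>4 q\<^sub>1 q\<^sub>2 = p\<^sup>n\<^sup>+\<^sup>1\<close>.  The coefficients are \<open>p + (n + 1) q\<^sub>1\<close> and \<open>p + (n + 1) q\<^sub>2\<close>, with sum
  \<open>D = n + 1 - (n - 1) p\<close>.  With \<open>S = \<bar>u\<bar>\<^sup>2\<close> and \<open>T = \<bar>v\<bar>\<^sup>2\<close> the condition on the ratio becomes
  \<open>D S = p + (n + 1) q\<^sub>1\<close> and \<open>D T = p + (n + 1) q\<^sub>2\<close>; multiplying the two equations gives \<open>4 S T\<close> as an
  explicit strictly increasing function of \<open>p\<close>.  Its inverse is the only implicit ingredient: the map
  from \<open>S\<^sup>3\<close> to the link and its local inverses are explicit in terms of \<open>p\<close>, and the pulled back form
  is \<open>D\<close> times the standard form.\<close>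

section \<open>Calculus of smooth maps\<close>

text \<open>The coefficients come from the arguments. If theta and phi are the arguments of u and v,
  the monomials have arguments theta + phi, (n + 1) theta and (n + 1) phi up to constants, and a
  positive factor changes no argument. So the form, the sum of |z_j|^2 d(arg z_j), pulls back to (p
  + (n + 1) q_1) dtheta + (p + (n + 1) q_2) dphi, against S dtheta + T dphi on the sphere; since S +
  T = 1, the conformal factor can only be the sum D. The delicate points are the coordinate axes,
  where an argument is undefined and p = 0. The map must be smooth there and have smooth local
  inverses, which is why it is written as monomials times positive functions that stay smooth,
  instead of in polar coordinates. No chart of the link is built from its equation: a map from the
  sphere with smooth local inverses, whose fibres are the orbits, transports the charts of the
  sphere to the link and to the lens space at once. The contactomorphism sends a point of the link
  to its fibre.\<close>

lemma Ck_on_subset: "Ck_on k f S \<Longrightarrow> T \<subseteq> S \<Longrightarrow> Ck_on k f T"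
  by (induction k arbitrary: f) (auto intro: continuous_on_subset)

lemma Ck_on_SucD:
  assumes "Ck_on (Suc k) f S"
  shows "x \<in> S \<Longrightarrow> (f has_derivative frechet_derivative f (at x)) (at x)"
    and "Ck_on k (\<lambda>x. frechet_derivative f (at x) v) S"
  using assms by (auto simp: frechet_derivative_works)

lemma Ck_on_cong:
  assumes "open S" "\<And>x. x \<in> S \<Longrightarrow> f x = g x" "Ck_on k f S"
  shows "Ck_on k g S"
  using assms
proof (induction k arbitrary: f g)
  case 0
  then show ?case by (auto cong: continuous_on_cong)
next
  case (Suc k)
  have der: "(g has_derivative frechet_derivative f (at x)) (at x)" if "x \<in> S" for x
    by (rule has_derivative_transform_within_open[OF Ck_on_SucD(1)[OF Suc.prems(3) that] Suc.prems(1) that])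
       (rule Suc.prems(2))
  have "Ck_on k (\<lambda>x. frechet_derivative g (at x) v) S" for v
    by (rule Suc.IH[OF Suc.prems(1) _ Ck_on_SucD(2)[OF Suc.prems(3), of v]])
       (use der frechet_derivative_at in metis)
  with der show ?case by (auto simp: differentiable_def)
qed

lemma Ck_on_SucI:
  assumes "open S" "\<And>x. x \<in> S \<Longrightarrow> (f has_derivative f' x) (at x)"
    and "\<And>v. Ck_on k (\<lambda>x. f' x v) S"
  shows "Ck_on (Suc k) f S"
proof -
  have "Ck_on k (\<lambda>x. frechet_derivative f (at x) v) S" for v
    by (rule Ck_on_cong[OF assms(1) _ assms(3)[of v]]) (use assms(2) frechet_derivative_at in metis)
  with assms(2) show ?thesis by (auto simp: differentiable_def)
qed

lemma Ck_on_SucD_lower: "Ck_on (Suc k) f S \<Longrightarrow> Ck_on k f S"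
proof (induction k arbitrary: f)
  case 0
  then show ?case
    by (auto intro!: continuous_at_imp_continuous_on differentiable_imp_continuous_within)
qed auto

lemma Ck_on_const: "open S \<Longrightarrow> Ck_on k (\<lambda>x. c) S"
  by (induction k arbitrary: c) (auto simp del: Ck_on.simps(2) intro!: Ck_on_SucI derivative_eq_intros)

lemma Ck_on_linear_compose:
  assumes "bounded_linear L" "open S" "Ck_on k f S"
  shows "Ck_on k (\<lambda>x. L (f x)) S"
  using assms(3)
proof (induction k arbitrary: f)
  case 0
  then show ?case using assms(1) by (auto intro: bounded_linear.continuous_on)
next
  case (Suc k)
  show ?case
    by (rule Ck_on_SucI[OF assms(2) bounded_linear.has_derivative[OF assms(1) Ck_on_SucD(1)[OF Suc.prems]]
          Suc.IH[OF Ck_on_SucD(2)[OF Suc.prems]]])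
qed

lemma Ck_on_add:
  assumes "open S" "Ck_on k f S" "Ck_on k g S"
  shows "Ck_on k (\<lambda>x. f x + g x) S"
  using assms(2,3)
proof (induction k arbitrary: f g)
  case 0
  then show ?case by (auto intro: continuous_on_add)
next
  case (Suc k)
  show ?case
    by (rule Ck_on_SucI[OF assms(1) has_derivative_add[OF Ck_on_SucD(1)[OF Suc.prems(1)] Ck_on_SucD(1)[OF Suc.prems(2)]]
        Suc.IH[OF Ck_on_SucD(2)[OF Suc.prems(1)] Ck_on_SucD(2)[OF Suc.prems(2)]]])
qed

lemma Ck_on_sum:
  assumes "open S" "\<And>i. i \<in> I \<Longrightarrow> Ck_on k (f i) S"
  shows "Ck_on k (\<lambda>x. \<Sum>i\<in>I. f i x) S"
  using assms(2)
  by (induction I rule: infinite_finite_induct) (auto intro: Ck_on_add Ck_on_const assms(1))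

lemma Ck_on_bilinear:
  assumes "bounded_bilinear B" "open S" "Ck_on k f S" "Ck_on k g S"
  shows "Ck_on k (\<lambda>x. B (f x) (g x)) S"
  using assms(3,4)
proof (induction k arbitrary: f g)
  case 0
  then show ?case using assms(1) by (auto intro: bounded_bilinear.continuous_on)
next
  case (Suc k)
  show ?case
    by (rule Ck_on_SucI[OF assms(2) bounded_bilinear.FDERIV[OF assms(1) Ck_on_SucD(1)[OF Suc.prems(1)] Ck_on_SucD(1)[OF Suc.prems(2)]]
        Ck_on_add[OF assms(2) Suc.IH[OF Ck_on_SucD_lower[OF Suc.prems(1)] Ck_on_SucD(2)[OF Suc.prems(2)]]
          Suc.IH[OF Ck_on_SucD(2)[OF Suc.prems(1)] Ck_on_SucD_lower[OF Suc.prems(2)]]]])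
qed

text \<open>Induction on \<open>k\<close> by the chain rule. \<open>Ck_on\<close> only controls
  derivatives in a fixed direction, while the chain rule applies the derivative of \<open>g\<close>
  to a vector that moves with \<open>x\<close>; expanding this vector in \<open>Basis\<close> leaves
  products of scalars with derivatives of \<open>g\<close> in fixed directions.\<close>

lemma Ck_on_compose:
  fixes f :: "'a::euclidean_space \<Rightarrow> 'b::euclidean_space"
  assumes "open S" "open T" "f ` S \<subseteq> T" "Ck_on k f S" "Ck_on k g T"
  shows "Ck_on k (\<lambda>x. g (f x)) S"
  using assms(4,5)
proof (induction k arbitrary: g)
  case 0
  then show ?case using assms(3) by (auto intro: continuous_on_compose2)
next
  case (Suc k)
  let ?f' = "\<lambda>x. frechet_derivative f (at x)" and ?g' = "\<lambda>y. frechet_derivative g (at y)"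
  have der: "((\<lambda>x. g (f x)) has_derivative (\<lambda>v. \<Sum>b\<in>Basis. (?f' x v \<bullet> b) *\<^sub>R ?g' (f x) b)) (at x)"
    if "x \<in> S" for x
  proof -
    have g: "(g has_derivative ?g' (f x)) (at (f x))"
      using Ck_on_SucD(1)[OF Suc.prems(2)] assms(3) that by blast
    then have lin: "linear (?g' (f x))" by (rule has_derivative_linear)
    have expand: "?g' (f x) w = (\<Sum>b\<in>Basis. (w \<bullet> b) *\<^sub>R ?g' (f x) b)" for w
    proof -
      have "?g' (f x) w = ?g' (f x) (\<Sum>b\<in>Basis. (w \<bullet> b) *\<^sub>R b)"
        by (simp only: euclidean_representation)
      also have "\<dots> = (\<Sum>b\<in>Basis. (w \<bullet> b) *\<^sub>R ?g' (f x) b)"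
        unfolding linear_sum[OF lin] linear_cmul[OF lin] ..
      finally show ?thesis .
    qed
    show ?thesis
      by (subst expand[symmetric]) (rule has_derivative_compose[OF Ck_on_SucD(1)[OF Suc.prems(1) that] g])
  qed
  have "Ck_on k (\<lambda>x. \<Sum>b\<in>Basis. (?f' x v \<bullet> b) *\<^sub>R ?g' (f x) b) S" for v
    by (rule Ck_on_sum[OF assms(1)])
       (rule Ck_on_bilinear[OF bounded_bilinear_scaleR assms(1)
          Ck_on_linear_compose[OF bounded_linear_inner_left assms(1) Ck_on_SucD(2)[OF Suc.prems(1)]]
          Suc.IH[OF Ck_on_SucD_lower[OF Suc.prems(1)] Ck_on_SucD(2)[OF Suc.prems(2)]]])
  from Ck_on_SucI[OF assms(1) der this] show ?case .
qed

text \<open>The real derivative is multiplication by \<open>deriv f x\<close>, which is again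
  holomorphic, so the induction closes. Reciprocals, square roots, \<open>Ln\<close> and
  \<open>exp\<close> all get their smoothness from here, the real ones through the embedding into
  the complex numbers.\<close>

lemma Ck_on_holomorphic:
  assumes "open S" "f holomorphic_on S"
  shows "Ck_on k f S"
  using assms(2)
proof (induction k arbitrary: f)
  case 0
  then show ?case by (simp add: holomorphic_on_imp_continuous_on)
next
  case (Suc k)
  have der: "(f has_derivative (*) (deriv f x)) (at x)" if "x \<in> S" for x
    using holomorphic_derivI[OF Suc.prems assms(1) that] by (rule has_field_derivative_imp_has_derivative)
  have "Ck_on k (\<lambda>x. deriv f x * v) S" for v
    by (rule Ck_on_linear_compose[OF bounded_linear_mult_left assms(1) Suc.IH])
       (rule holomorphic_deriv[OF Suc.prems assms(1)])
  from Ck_on_SucI[OF assms(1) der this] show ?case .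
qed


text \<open>Smoothness on some neighbourhood of the point; in this form the closure rules compose
  without bookkeeping of open sets.\<close>

definition smooth_at :: "('a::euclidean_space \<Rightarrow> 'b::real_normed_vector) \<Rightarrow> 'a \<Rightarrow> bool" where
  "smooth_at f x \<longleftrightarrow> (\<exists>W. open W \<and> x \<in> W \<and> (\<forall>k. Ck_on k f W))"

lemma smooth_atI: "open W \<Longrightarrow> x \<in> W \<Longrightarrow> (\<And>k. Ck_on k f W) \<Longrightarrow> smooth_at f x"
  by (auto simp: smooth_at_def)

lemma smooth_at_imp_differentiable: "smooth_at f x \<Longrightarrow> f differentiable (at x)"
  unfolding smooth_at_def by (metis Ck_on.simps(2))

lemma smooth_at_transform:
  assumes "smooth_at f x" "open W" "x \<in> W" "\<And>y. y \<in> W \<Longrightarrow> f y = g y"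
  shows "smooth_at g x"
proof -
  obtain V where V: "open V" "x \<in> V" "\<And>k. Ck_on k f V"
    using assms(1) by (auto simp: smooth_at_def)
  show ?thesis
  proof (rule smooth_atI)
    show "Ck_on k g (V \<inter> W)" for k
      by (rule Ck_on_cong[where f = f]) (use V assms Ck_on_subset[OF V(3)] in auto)
  qed (use V assms in auto)
qed

lemma smooth_at_compose:
  fixes f :: "'a::euclidean_space \<Rightarrow> 'b::euclidean_space"
  assumes "smooth_at f x" "smooth_at g (f x)"
  shows "smooth_at (\<lambda>x. g (f x)) x"
proof -
  obtain V W where V: "open V" "x \<in> V" "\<And>k. Ck_on k f V"
    and W: "open W" "f x \<in> W" "\<And>k. Ck_on k g W"
    using assms by (auto simp: smooth_at_def)
  have "continuous_on V f" using V(3)[of 0] by simp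
  then have op: "open (V \<inter> f -` W)"
    using V(1) W(1) by (simp add: continuous_open_preimage)
  show ?thesis
  proof (rule smooth_atI[OF op])
    show "Ck_on k (\<lambda>x. g (f x)) (V \<inter> f -` W)" for k
      by (rule Ck_on_compose[OF op W(1) _ Ck_on_subset[OF V(3)] W(3)]) auto
  qed (use V W in auto)
qed

lemma smooth_at_bilinear:
  assumes "bounded_bilinear B" "smooth_at f x" "smooth_at g x"
  shows "smooth_at (\<lambda>x. B (f x) (g x)) x"
proof -
  obtain V W where V: "open V" "x \<in> V" "\<And>k. Ck_on k f V"
    and W: "open W" "x \<in> W" "\<And>k. Ck_on k g W"
    using assms by (auto simp: smooth_at_def)
  show ?thesis
  proof (rule smooth_atI)
    show "Ck_on k (\<lambda>x. B (f x) (g x)) (V \<inter> W)" for k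
      by (rule Ck_on_bilinear[OF assms(1) _ Ck_on_subset[OF V(3)] Ck_on_subset[OF W(3)]]) (use V W in auto)
  qed (use V W in auto)
qed

lemma smooth_at_linear:
  assumes "bounded_linear L" "smooth_at f x"
  shows "smooth_at (\<lambda>x. L (f x)) x"
  using assms(2) Ck_on_linear_compose[OF assms(1)] unfolding smooth_at_def by blast

lemma smooth_at_const: "smooth_at (\<lambda>x. c) x"
  by (rule smooth_atI[of UNIV]) (auto intro: Ck_on_const)

lemma smooth_at_id: "smooth_at (\<lambda>x. x) x"
proof (rule smooth_atI[of UNIV])
  show "Ck_on k (\<lambda>x. x) UNIV" for k
    by (cases k) (auto simp del: Ck_on.simps(2) intro!: Ck_on_SucI derivative_intros Ck_on_const)
qed auto

lemma smooth_at_add: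
  assumes "smooth_at f x" "smooth_at g x"
  shows "smooth_at (\<lambda>x. f x + g x) x"
proof -
  obtain V W where V: "open V" "x \<in> V" "\<And>k. Ck_on k f V"
    and W: "open W" "x \<in> W" "\<And>k. Ck_on k g W"
    using assms by (auto simp: smooth_at_def)
  show ?thesis
  proof (rule smooth_atI)
    show "Ck_on k (\<lambda>x. f x + g x) (V \<inter> W)" for k
      by (rule Ck_on_add[OF _ Ck_on_subset[OF V(3)] Ck_on_subset[OF W(3)]]) (use V W in auto)
  qed (use V W in auto)
qed

lemma smooth_at_diff:
  assumes "smooth_at f x" "smooth_at g x"
  shows "smooth_at (\<lambda>x. f x - g x) x"
  using smooth_at_add[OF assms(1) smooth_at_linear[OF bounded_linear_minus[OF bounded_linear_ident] assms(2)]]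
  by simp

lemma smooth_at_sum:
  assumes "\<And>i. i \<in> I \<Longrightarrow> smooth_at (f i) x"
  shows "smooth_at (\<lambda>x. \<Sum>i\<in>I. f i x) x"
  using assms by (induction I rule: infinite_finite_induct) (auto intro: smooth_at_add smooth_at_const)

lemmas smooth_at_mult = smooth_at_bilinear[OF bounded_bilinear_mult]
lemmas smooth_at_scaleR = smooth_at_bilinear[OF bounded_bilinear_scaleR]
lemmas smooth_at_inner = smooth_at_bilinear[OF bounded_bilinear_inner]
lemmas smooth_at_of_real = smooth_at_linear[OF bounded_linear_of_real]

lemma smooth_at_power:
  fixes f :: "'a::euclidean_space \<Rightarrow> 'b::real_normed_algebra_1"
  shows "smooth_at f x \<Longrightarrow> smooth_at (\<lambda>x. f x ^ m) x"
  by (induction m) (auto intro: smooth_at_const smooth_at_mult)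

lemma smooth_at_holomorphic:
  assumes "f holomorphic_on S" "open S" "g x \<in> S" "smooth_at g x"
  shows "smooth_at (\<lambda>x. f (g x)) x"
  using assms by (intro smooth_at_compose[OF assms(4)]) (auto intro: smooth_atI Ck_on_holomorphic)

lemma smooth_at_real_holomorphic:
  fixes g :: "'a::euclidean_space \<Rightarrow> real"
  assumes "f holomorphic_on S" "open S" "complex_of_real (g x) \<in> S" "smooth_at g x"
  shows "smooth_at (\<lambda>x. Re (f (of_real (g x)))) x"
  by (rule smooth_at_linear[OF bounded_linear_Re]
      smooth_at_holomorphic[where f = f, OF assms(1,2)] smooth_at_of_real assms)+

lemma smooth_at_inverse:
  fixes f :: "'a::euclidean_space \<Rightarrow> complex"
  assumes "f x \<noteq> 0" "smooth_at f x"
  shows "smooth_at (\<lambda>x. inverse (f x)) x"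
  by (rule smooth_at_holomorphic[of _ "- {0}"]) (use assms in \<open>auto intro: holomorphic_intros\<close>)

lemma smooth_at_divide:
  fixes f g :: "'a::euclidean_space \<Rightarrow> complex"
  assumes "g x \<noteq> 0" "smooth_at f x" "smooth_at g x"
  shows "smooth_at (\<lambda>x. f x / g x) x"
  using smooth_at_mult[OF assms(2) smooth_at_inverse[OF assms(1,3)]] by (simp add: divide_inverse)

lemma smooth_at_divide_real:
  fixes f g :: "'a::euclidean_space \<Rightarrow> real"
  assumes "g x \<noteq> 0" "smooth_at f x" "smooth_at g x"
  shows "smooth_at (\<lambda>x. f x / g x) x"
proof -
  have "smooth_at (\<lambda>x. Re (of_real (f x) / of_real (g x))) x"
    by (intro smooth_at_linear[OF bounded_linear_Re] smooth_at_divide smooth_at_of_real)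
       (use assms in auto)
  then show ?thesis by (simp flip: of_real_divide)
qed

lemma smooth_at_sqrt:
  fixes f :: "'a::euclidean_space \<Rightarrow> real"
  assumes "f x > 0" "smooth_at f x"
  shows "smooth_at (\<lambda>x. sqrt (f x)) x"
proof -
  have "smooth_at (\<lambda>x. Re (csqrt (of_real (f x)))) x"
    by (rule smooth_at_real_holomorphic[of _ "- \<real>\<^sub>\<le>\<^sub>0"])
       (use assms in \<open>auto intro!: holomorphic_intros\<close>)
  \<comment> \<open>On reals, \<open>Re (csqrt y)\<close> agrees with \<open>sqrt y\<close> only for
    \<open>y >= 0\<close>, so the two functions are compared on the open set where \<open>f\<close>
    is positive.\<close>
  moreover obtain V where V: "open V" "x \<in> V" "\<And>k. Ck_on k f V" using assms(2) by (auto simp: smooth_at_def)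
  have "continuous_on V f" using V(3)[of 0] by simp
  then have "open (V \<inter> f -` {0<..})" using V by (simp add: continuous_open_preimage)
  ultimately show ?thesis
    by (rule smooth_at_transform) (use V assms in auto)
qed

lemma smooth_at_vec:
  fixes f :: "'a::euclidean_space \<Rightarrow> 'b::euclidean_space ^ 'n"
  assumes "\<And>i. smooth_at (\<lambda>x. f x $ i) x"
  shows "smooth_at f x"
proof -
  have "linear (axis i :: 'b \<Rightarrow> 'b ^ 'n)" for i
    by (rule linearI) (auto simp: axis_def vec_eq_iff)
  then have "bounded_linear (axis i :: 'b \<Rightarrow> 'b ^ 'n)" for i
    by (simp add: linear_linear)
  then have "smooth_at (\<lambda>x. \<Sum>i\<in>UNIV. axis i (f x $ i)) x"
    by (rule smooth_at_sum[OF smooth_at_linear[OF _ assms]])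
  moreover have "(\<Sum>i\<in>UNIV. axis i (f x $ i)) = f x" for x
    by (simp add: vec_eq_iff axis_def if_distrib[where f = "\<lambda>v. v $ _"] cong: if_cong)
  ultimately show ?thesis by simp
qed

lemma Ck_on_local:
  assumes "\<And>x. x \<in> S \<Longrightarrow> \<exists>W. open W \<and> x \<in> W \<and> Ck_on k f W"
  shows "Ck_on k f S"
  using assms
proof (induction k arbitrary: f)
  case 0
  then have "isCont f x" if "x \<in> S" for x
    using that by (metis Ck_on.simps(1) continuous_on_eq_continuous_at)
  then show ?case by (simp add: continuous_at_imp_continuous_on)
next
  case (Suc k)
  have "Ck_on k (\<lambda>x. frechet_derivative f (at x) v) S" for v
    by (rule Suc.IH) (use Suc.prems in fastforce)
  moreover have "f differentiable (at x)" if "x \<in> S" for x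
    using Suc.prems[OF that] by auto
  ultimately show ?case by simp
qed

lemma Ck_on_smooth_at: "(\<And>x. x \<in> S \<Longrightarrow> smooth_at f x) \<Longrightarrow> Ck_on k f S"
  by (rule Ck_on_local) (auto simp: smooth_at_def)

text \<open>Bootstrapping: the derivative of the inverse \<open>g\<close> is \<open>1 / f'\<close>
  composed with \<open>g\<close>, so if \<open>g\<close> is C^k then its derivative is too, and
  \<open>g\<close> is C^(k+1). Openness of the image is invariance of domain.\<close>

lemma smooth_at_inverse_function:
  fixes f f' :: "real \<Rightarrow> real"
  assumes "open I"
    and inj: "inj_on f I"
    and der: "\<And>x. x \<in> I \<Longrightarrow> (f has_real_derivative f' x) (at x)"
    and nz: "\<And>x. x \<in> I \<Longrightarrow> f' x \<noteq> 0"
    and sm: "\<And>x. x \<in> I \<Longrightarrow> smooth_at f' x"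
    and y: "y \<in> f ` I"
  shows "smooth_at (inv_into I f) y"
proof -
  let ?g = "inv_into I f"
  have cont: "continuous_on I f"
    using der by (meson DERIV_continuous continuous_at_imp_continuous_on)
  have op: "open (f ` I)"
    by (rule invariance_of_domain[OF cont \<open>open I\<close> inj])
  have g_in: "?g ` (f ` I) \<subseteq> I" by (auto intro: inv_into_into)
  have gder: "(?g has_derivative (*) (1 / f' (?g y))) (at y)" if y: "y \<in> f ` I" for y
  proof -
    obtain x where x: "x \<in> I" "y = f x" using y by blast
    have "(?g has_derivative (*) (1 / f' x)) (at (f x))"
    proof (rule has_derivative_inverse_strong[OF \<open>open I\<close> x(1) cont])
      show "(f has_derivative (*) (f' x)) (at x)"
        by (rule has_field_derivative_imp_has_derivative[OF der[OF x(1)]])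
      show "?g (f t) = t" if "t \<in> I" for t using inj that by simp
      show "(*) (f' x) \<circ> (*) (1 / f' x) = id" using nz[OF x(1)] by (auto simp: fun_eq_iff)
    qed
    moreover have "?g y = x" using x inj by simp
    ultimately show ?thesis using x(2) by metis
  qed
  have "Ck_on k ?g (f ` I)" for k
  proof (induction k)
    case 0
    have "isCont ?g y" if "y \<in> f ` I" for y
      using gder[OF that] by (rule has_derivative_continuous)
    then show ?case by (simp add: continuous_at_imp_continuous_on)
  next
    case (Suc k)
    have "Ck_on k (\<lambda>x. 1 / f' x) I"
      by (rule Ck_on_smooth_at) (intro smooth_at_divide_real smooth_at_const sm nz)
    from Ck_on_linear_compose[OF bounded_linear_mult_left op Ck_on_compose[OF op \<open>open I\<close> g_in Suc this]]
    have "Ck_on k (\<lambda>y. 1 / f' (?g y) * v) (f ` I)" for v .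
    from Ck_on_SucI[OF op gder this] show ?case .
  qed
  then show ?thesis by (rule smooth_atI[OF op y])
qed

section \<open>Smoothness on arbitrary subsets via local extensions\<close>

lemma smooth_on_iff:
  "smooth_on S f \<longleftrightarrow>
    (\<forall>x\<in>S. \<exists>g W. open W \<and> x \<in> W \<and> smooth_at g x \<and> (\<forall>y\<in>S \<inter> W. g y = f y))"
proof (intro iffI ballI)
  fix x assume "smooth_on S f" and x: "x \<in> S"
  then obtain W g where "open W" "x \<in> W" "\<forall>k. Ck_on k g W" "\<forall>y\<in>S \<inter> W. g y = f y"
    by (auto simp: smooth_on_def)
  then show "\<exists>g W. open W \<and> x \<in> W \<and> smooth_at g x \<and> (\<forall>y\<in>S \<inter> W. g y = f y)"
    by (intro exI[of _ g] exI[of _ W]) (simp add: smooth_atI)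
next
  assume *: "\<forall>x\<in>S. \<exists>g W. open W \<and> x \<in> W \<and> smooth_at g x \<and> (\<forall>y\<in>S \<inter> W. g y = f y)"
  show "smooth_on S f"
    unfolding smooth_on_def
  proof
    fix x assume "x \<in> S"
    with * obtain g W where g: "open W" "x \<in> W" "smooth_at g x" "\<forall>y\<in>S \<inter> W. g y = f y"
      by auto
    then obtain V where V: "open V" "x \<in> V" "\<forall>k. Ck_on k g V"
      by (auto simp: smooth_at_def)
    have "Ck_on k g (V \<inter> W)" for k by (rule Ck_on_subset[of k g V]) (simp_all add: V)
    with g V show "\<exists>W g. open W \<and> x \<in> W \<and> (\<forall>k. Ck_on k g W) \<and> (\<forall>y\<in>S \<inter> W. g y = f y)"
      by (intro exI[of _ "V \<inter> W"] exI[of _ g]) auto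
  qed
qed

lemma smooth_onI: "(\<And>x. x \<in> S \<Longrightarrow> smooth_at f x) \<Longrightarrow> smooth_on S f"
  by (auto simp: smooth_on_iff)

lemma smooth_on_localD:
  assumes "smooth_on S f" "x \<in> S"
  obtains g W where "open W" "x \<in> W" "smooth_at g x" "\<forall>y\<in>S \<inter> W. g y = f y"
  using assms unfolding smooth_on_iff by metis

lemma smooth_on_subset:
  assumes "smooth_on S f" "T \<subseteq> S"
  shows "smooth_on T f"
  unfolding smooth_on_iff
proof
  fix x assume "x \<in> T"
  then have "x \<in> S" using assms(2) by blast
  with assms(1) obtain g W where "open W" "x \<in> W" "smooth_at g x" "\<forall>y\<in>S \<inter> W. g y = f y"
    by (rule smooth_on_localD)
  then show "\<exists>g W. open W \<and> x \<in> W \<and> smooth_at g x \<and> (\<forall>y\<in>T \<inter> W. g y = f y)"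
    using assms(2) by (intro exI[of _ g] exI[of _ W]) auto
qed

lemma smooth_on_cong:
  assumes "smooth_on S f" "\<And>x. x \<in> S \<Longrightarrow> f x = g x"
  shows "smooth_on S g"
  using assms unfolding smooth_on_iff by simp

lemma smooth_on_openD:
  assumes "smooth_on S f" "open S" "x \<in> S"
  shows "smooth_at f x"
proof -
  obtain g W where "open W" "x \<in> W" "smooth_at g x" "\<forall>y\<in>S \<inter> W. g y = f y"
    by (rule smooth_on_localD[OF assms(1,3)])
  then show ?thesis
    using assms(2,3) by (elim smooth_at_transform[of g x "S \<inter> W"]) auto
qed

lemma smooth_at_preimage:
  assumes "smooth_at f x" "open W" "f x \<in> W"
  obtains V where "open V" "x \<in> V" "f ` V \<subseteq> W"
proof -
  obtain V where V: "open V" "x \<in> V" "\<And>k. Ck_on k f V"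
    using assms by (auto simp: smooth_at_def)
  have "continuous_on V f" using V(3)[of 0] by simp
  then have "open (V \<inter> f -` W)"
    using V(1) assms(2) by (simp add: continuous_open_preimage)
  then show thesis by (rule that) (use V assms in auto)
qed

lemma smooth_on_continuous_on:
  assumes "smooth_on S f"
  shows "continuous_on S f"
proof (clarsimp simp: continuous_on_eq_continuous_within)
  fix x assume x: "x \<in> S"
  obtain g W where g: "open W" "x \<in> W" "smooth_at g x" "\<forall>y\<in>S \<inter> W. g y = f y"
    by (rule smooth_on_localD[OF assms x])
  have "isCont g x"
    by (rule differentiable_imp_continuous_within[OF smooth_at_imp_differentiable[OF g(3)]])
  then have "continuous (at x within S \<inter> W) g"
    by (rule continuous_at_imp_continuous_at_within)
  then have "continuous (at x within S \<inter> W) f"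
    by (rule continuous_transform_within[where \<delta> = 1]) (use g x in auto)
  moreover have "at x within S \<inter> W = at x within S"
    by (rule at_within_nhd[of x W]) (use g in auto)
  ultimately show "continuous (at x within S) f" by simp
qed

lemma smooth_on_compose:
  fixes f :: "'a::euclidean_space \<Rightarrow> 'b::euclidean_space"
  assumes "smooth_on S f" "smooth_on T g" "f ` S \<subseteq> T"
  shows "smooth_on S (\<lambda>x. g (f x))"
  unfolding smooth_on_iff
proof
  fix x assume x: "x \<in> S"
  then have fx: "f x \<in> T" using assms(3) by blast
  obtain f1 V where V: "open V" "x \<in> V" "smooth_at f1 x" "\<forall>y\<in>S \<inter> V. f1 y = f y"
    by (rule smooth_on_localD[OF assms(1) x])
  obtain g1 W where W: "open W" "f x \<in> W" "smooth_at g1 (f x)" "\<forall>y\<in>T \<inter> W. g1 y = g y"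
    by (rule smooth_on_localD[OF assms(2) fx])
  have eq: "f1 x = f x" using V x by auto
  obtain U where U: "open U" "x \<in> U" "f1 ` U \<subseteq> W"
    by (rule smooth_at_preimage[OF V(3) W(1)]) (use eq W in auto)
  have "smooth_at (\<lambda>x. g1 (f1 x)) x"
    by (rule smooth_at_compose[OF V(3)]) (use eq W in simp)
  moreover have "g1 (f1 y) = g (f y)" if "y \<in> S \<inter> (U \<inter> V)" for y
  proof -
    have "f1 y = f y" "f1 y \<in> W" "f y \<in> T" using that U(3) V(4) assms(3) by auto
    then show ?thesis using W(4) by auto
  qed
  ultimately show "\<exists>h W. open W \<and> x \<in> W \<and> smooth_at h x \<and> (\<forall>y\<in>S \<inter> W. h y = g (f y))"
    using U V by (intro exI[of _ "U \<inter> V"] exI[of _ "\<lambda>x. g1 (f1 x)"]) auto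
qed

section \<open>Atlases, tangent vectors and differentials\<close>

declare split_paired_All [simp del] split_paired_Ex [simp del]

lemma param_coord: "inj_on (coord c) (dom_chart c) \<Longrightarrow> x \<in> dom_chart c \<Longrightarrow> param c (coord c x) = x"
  by (simp add: param_def)

lemma coord_param: "y \<in> coord c ` dom_chart c \<Longrightarrow> coord c (param c y) = y"
  unfolding param_def by (rule f_inv_into_f)

lemma param_in_dom: "y \<in> coord c ` dom_chart c \<Longrightarrow> param c y \<in> dom_chart c"
  unfolding param_def by (rule inv_into_into)

text \<open>Tangent vectors and differentials see only first derivatives of coordinate changes, so
  differentiability is what is recorded. The set \<open>W\<close> is there because
  \<open>param c\<close> is total: the coordinate change has its meaning only where
  \<open>param c\<close> lands in \<open>dom_chart d\<close>.\<close>

definition smooth_atlas :: "('a, 'e::euclidean_space) manifold \<Rightarrow> bool" where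
  "smooth_atlas M \<longleftrightarrow>
     (\<forall>c\<in>atlas M. inj_on (coord c) (dom_chart c) \<and> open (coord c ` dom_chart c)) \<and>
     (\<forall>p c d. c \<in> charts_at M p \<longrightarrow> d \<in> charts_at M p \<longrightarrow>
       (\<exists>W. open W \<and> coord c p \<in> W \<and> W \<subseteq> coord c ` dom_chart c \<and> param c ` W \<subseteq> dom_chart d) \<and>
       (\<lambda>x. coord d (param c x)) differentiable (at (coord c p)))"

lemma smooth_atlas_chart:
  assumes "smooth_atlas M" "c \<in> charts_at M p"
  shows "inj_on (coord c) (dom_chart c)" "open (coord c ` dom_chart c)" "p \<in> dom_chart c"
    "param c (coord c p) = p"
  using assms by (auto simp: smooth_atlas_def charts_at_def param_coord)

lemma smooth_atlas_transition:
  assumes "smooth_atlas M" "c \<in> charts_at M p" "d \<in> charts_at M p"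
  obtains W where "open W" "coord c p \<in> W" "W \<subseteq> coord c ` dom_chart c" "param c ` W \<subseteq> dom_chart d"
  using assms unfolding smooth_atlas_def by metis

lemma smooth_atlas_differentiable:
  assumes "smooth_atlas M" "c \<in> charts_at M p" "d \<in> charts_at M p"
  shows "(\<lambda>x. coord d (param c x)) differentiable (at (coord c p))"
  using assms unfolding smooth_atlas_def by metis

lemma has_derivative_change_chart:
  assumes M: "smooth_atlas M" and c: "c \<in> charts_at M p" and d: "d \<in> charts_at M p"
    and f: "(\<lambda>x. f (param d x)) differentiable (at (coord d p))"
  shows "((\<lambda>x. f (param c x)) has_derivative
      (\<lambda>w. frechet_derivative (\<lambda>x. f (param d x)) (at (coord d p))
        (frechet_derivative (\<lambda>x. coord d (param c x)) (at (coord c p)) w))) (at (coord c p))"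
proof -
  obtain W where W: "open W" "coord c p \<in> W" "W \<subseteq> coord c ` dom_chart c" "param c ` W \<subseteq> dom_chart d"
    by (rule smooth_atlas_transition[OF M c d])
  have t: "((\<lambda>x. coord d (param c x)) has_derivative
      frechet_derivative (\<lambda>x. coord d (param c x)) (at (coord c p))) (at (coord c p))"
    using smooth_atlas_differentiable[OF M c d] by (simp add: frechet_derivative_works)
  have "((\<lambda>x. f (param d x)) has_derivative
      frechet_derivative (\<lambda>x. f (param d x)) (at (coord d p))) (at (coord d (param c (coord c p))))"
    using f smooth_atlas_chart(4)[OF M c] by (simp add: frechet_derivative_works)
  from has_derivative_compose[OF t this]
  show ?thesis
  proof (rule has_derivative_transform_within_open[OF _ W(1,2)])
    fix x assume "x \<in> W"
    then have "param c x \<in> dom_chart d" using W by blast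
    then show "f (param d (coord d (param c x))) = f (param c x)"
      by (simp add: param_coord[OF smooth_atlas_chart(1)[OF M d]])
  qed
qed

text \<open>A tangent vector is a family over all charts; this is the one with coordinates
  \<open>w\<close> in \<open>c\<close>. For a chart around \<open>p\<close> in a smooth atlas it
  identifies the model space with the tangent space, with inverse
  \<open>v \<mapsto> v c\<close>.\<close>

definition tangent_of_chart ::
  "('a, 'e::euclidean_space) manifold \<Rightarrow> 'a \<Rightarrow> ('a, 'e) chart \<Rightarrow> 'e \<Rightarrow> ('a, 'e) tangent" where
  "tangent_of_chart M p c w =
     (\<lambda>d. if d \<in> charts_at M p then frechet_derivative (\<lambda>x. coord d (param c x)) (at (coord c p)) w else 0)"

lemma tangent_of_chart_in_tangent_space:
  assumes M: "smooth_atlas M" and c: "c \<in> charts_at M p"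
  shows "tangent_of_chart M p c w \<in> tangent_space M p"
proof -
  have cocycle: "frechet_derivative (\<lambda>x. coord e (param c x)) (at (coord c p)) w =
      frechet_derivative (\<lambda>x. coord e (param d x)) (at (coord d p))
        (frechet_derivative (\<lambda>x. coord d (param c x)) (at (coord c p)) w)"
    if d: "d \<in> charts_at M p" and e: "e \<in> charts_at M p" for d e
  proof -
    have "(\<lambda>x. coord e (param d x)) differentiable (at (coord d p))"
      by (rule smooth_atlas_differentiable[OF M d e])
    from fun_cong[OF frechet_derivative_at[OF has_derivative_change_chart[OF M c d this]]] show ?thesis
      by (rule sym)
  qed
  show ?thesis
    unfolding tangent_space_def tangent_of_chart_def
    by (intro CollectI conjI ballI allI impI, simp only: if_True, rule cocycle) simp_all
qed

lemma tangent_of_chart_self: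
  assumes M: "smooth_atlas M" and c: "c \<in> charts_at M p"
  shows "tangent_of_chart M p c w c = w"
proof -
  have "((\<lambda>x. coord c (param c x)) has_derivative (\<lambda>x. x)) (at (coord c p))"
  proof (rule has_derivative_transform_within_open[OF has_derivative_ident])
    show "open (coord c ` dom_chart c)" by (rule smooth_atlas_chart(2)[OF M c])
    show "coord c p \<in> coord c ` dom_chart c" using smooth_atlas_chart(3)[OF M c] by blast
  qed (simp add: coord_param)
  from frechet_derivative_at[OF this] c show ?thesis
    by (simp add: tangent_of_chart_def fun_eq_iff)
qed

lemma tangent_space_eq_tangent_of_chart:
  assumes "v \<in> tangent_space M p" "c \<in> charts_at M p"
  shows "v = tangent_of_chart M p c (v c)"
proof
  show "v d = tangent_of_chart M p c (v c) d" for d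
    using assms unfolding tangent_space_def tangent_of_chart_def mem_Collect_eq by metis
qed

text \<open>The chart chosen by \<open>SOME\<close> is unknown; the change of chart formula and the
  compatibility of the family \<open>v\<close> move the computation to any chart at hand.\<close>

lemma fun_differential_eq:
  assumes M: "smooth_atlas M" and c: "c \<in> charts_at M p" and v: "v \<in> tangent_space M p"
    and f: "(\<lambda>x. f (param c x)) differentiable (at (coord c p))"
  shows "fun_differential M f p v = frechet_derivative (\<lambda>x. f (param c x)) (at (coord c p)) (v c)"
proof -
  define d where "d = (SOME c. c \<in> charts_at M p)"
  have d: "d \<in> charts_at M p" unfolding d_def by (rule someI[of _ c]) (rule c)
  have "frechet_derivative (\<lambda>x. coord c (param d x)) (at (coord d p)) (v d) = v c"
    using v c d unfolding tangent_space_def mem_Collect_eq by metis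
  with fun_cong[OF frechet_derivative_at[OF has_derivative_change_chart[OF M d c f]], of "v d"] show ?thesis
    by (simp add: fun_differential_def flip: d_def)
qed


text \<open>All maps between manifolds considered below are the identity in suitable charts, which makes
  their smoothness and their differentials immediate.\<close>

definition matching :: "('a \<Rightarrow> 'b) \<Rightarrow> ('a, 'e) chart \<Rightarrow> ('b, 'e) chart \<Rightarrow> bool" where
  "matching f c d \<longleftrightarrow> f ` dom_chart c = dom_chart d \<and> (\<forall>x\<in>dom_chart c. coord d (f x) = coord c x)"

lemma matching_image: "matching f c d \<Longrightarrow> coord d ` dom_chart d = coord c ` dom_chart c"
  unfolding matching_def by force

lemma matching_param:
  assumes "matching f c d" "inj_on (coord d) (dom_chart d)" "y \<in> coord c ` dom_chart c"
  shows "f (param c y) = param d y"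
proof -
  have "param c y \<in> dom_chart c" "coord c (param c y) = y"
    using assms(3) by (simp_all add: param_in_dom coord_param)
  then have "f (param c y) \<in> dom_chart d" "coord d (f (param c y)) = y"
    using assms(1) unfolding matching_def by auto
  then show ?thesis using param_coord[OF assms(2)] by metis
qed

text \<open>In matching charts \<open>f\<close> is the identity, so the coordinate vector
  \<open>v c\<close> passes unchanged from \<open>c\<close> to \<open>d\<close>. All later
  statements on differentials reduce to this.\<close>

lemma differential_matching:
  assumes M: "smooth_atlas M" and N: "smooth_atlas N"
    and c: "c \<in> charts_at M p" and d: "d \<in> charts_at N (f p)" and m: "matching f c d"
    and v: "v \<in> tangent_space M p"
  shows "differential M N f p v = tangent_of_chart N (f p) d (v c)"
proof -
  have "fun_differential M (\<lambda>q. coord e (f q)) p v =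
      frechet_derivative (\<lambda>x. coord e (param d x)) (at (coord d (f p))) (v c)"
    if e: "e \<in> charts_at N (f p)" for e
  proof -
    let ?g = "\<lambda>x. coord e (f (param c x))"
    have cd: "coord d (f p) = coord c p"
      using m smooth_atlas_chart(3)[OF M c] by (auto simp: matching_def)
    have "(\<lambda>x. coord e (param d x)) differentiable (at (coord d (f p)))"
      by (rule smooth_atlas_differentiable[OF N d e])
    then have "((\<lambda>x. coord e (param d x)) has_derivative
        frechet_derivative (\<lambda>x. coord e (param d x)) (at (coord d (f p)))) (at (coord c p))"
      by (simp add: frechet_derivative_works cd)
    then have g: "(?g has_derivative
        frechet_derivative (\<lambda>x. coord e (param d x)) (at (coord d (f p)))) (at (coord c p))"
    proof (rule has_derivative_transform_within_open)
      show "open (coord c ` dom_chart c)" by (rule smooth_atlas_chart(2)[OF M c])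
      show "coord c p \<in> coord c ` dom_chart c" using smooth_atlas_chart(3)[OF M c] by blast
    qed (simp add: matching_param[OF m smooth_atlas_chart(1)[OF N d]])
    then have "?g differentiable (at (coord c p))" by (rule differentiableI)
    from fun_differential_eq[OF M c v this] fun_cong[OF frechet_derivative_at[OF g], of "v c"] show ?thesis by simp
  qed
  then show ?thesis by (auto simp: differential_def tangent_of_chart_def)
qed

lemma smooth_map_of_matching:
  assumes "\<And>p. p \<in> points M \<Longrightarrow> f p \<in> points N"
    and "\<And>p. p \<in> points M \<Longrightarrow> \<exists>c\<in>charts_at M p. \<exists>d\<in>charts_at N (f p). matching f c d"
    and M: "smooth_atlas M" and N: "smooth_atlas N"
  shows "smooth_map M N f"
  unfolding smooth_map_def
proof (intro conjI ballI)
  show "f ` points M \<subseteq> points N" using assms(1) by blast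
next
  fix p assume "p \<in> points M"
  then obtain c d where c: "c \<in> charts_at M p" and d: "d \<in> charts_at N (f p)" and m: "matching f c d"
    using assms(2) by blast
  let ?W = "coord c ` dom_chart c"
  have "smooth_on ?W (\<lambda>x. coord d (f (param c x)))"
    by (rule smooth_on_cong[OF smooth_onI[OF smooth_at_id]])
       (use m in \<open>simp add: matching_def param_in_dom coord_param\<close>)
  moreover have "f ` param c ` ?W \<subseteq> dom_chart d"
    using m by (auto simp: matching_def param_in_dom)
  ultimately show "\<exists>c\<in>charts_at M p. \<exists>d\<in>charts_at N (f p). \<exists>W.
        open W \<and> coord c p \<in> W \<and> W \<subseteq> coord c ` dom_chart c \<and>
        f ` param c ` W \<subseteq> dom_chart d \<and> smooth_on W (\<lambda>x. coord d (f (param c x)))"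
    using c d smooth_atlas_chart(2,3)[OF M c] by (intro bexI[OF _ c] bexI[OF _ d] exI[of _ ?W]) auto
qed

text \<open>Charts that match for \<open>f\<close> match for its inverse with the roles exchanged,
  so one smoothness criterion serves both directions. The inclusion of \<open>dom_chart c\<close> in
  \<open>points M\<close> lets \<open>inv_into\<close> undo \<open>f\<close> on the whole
  chart.\<close>

lemma diffeomorphism_of_matching:
  assumes bij: "bij_betw f (points M) (points N)"
    and m: "\<And>p. p \<in> points M \<Longrightarrow>
      \<exists>c\<in>charts_at M p. \<exists>d\<in>charts_at N (f p). dom_chart c \<subseteq> points M \<and> matching f c d"
    and M: "smooth_atlas M" and N: "smooth_atlas N"
  shows "diffeomorphism M N f"
  unfolding diffeomorphism_def
proof (intro conjI)
  show "bij_betw f (points M) (points N)" by fact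
  show "smooth_map M N f"
  proof (rule smooth_map_of_matching[OF _ _ M N])
    show "f p \<in> points N" if "p \<in> points M" for p
      using that bij by (auto simp: bij_betw_def)
    show "\<exists>c\<in>charts_at M p. \<exists>d\<in>charts_at N (f p). matching f c d" if "p \<in> points M" for p
      using m[OF that] by blast
  qed
  let ?g = "inv_into (points M) f"
  have g: "?g q \<in> points M" "f (?g q) = q" if "q \<in> points N" for q
    using that bij by (auto simp: bij_betw_def f_inv_into_f inv_into_into)
  have gf: "?g (f p) = p" if "p \<in> points M" for p
    using that bij by (auto simp: bij_betw_def)
  show "smooth_map N M ?g"
  proof (rule smooth_map_of_matching[OF g(1) _ N M])
    fix q assume q: "q \<in> points N"
    then obtain c d where c: "c \<in> charts_at M (?g q)" and d: "d \<in> charts_at N q"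
      and sub: "dom_chart c \<subseteq> points M" and mat: "matching f c d"
      using m[OF g(1)[OF q]] unfolding g(2)[OF q] by blast
    have gfc: "?g (f x) = x" if "x \<in> dom_chart c" for x
      using gf sub that by blast
    have im: "dom_chart d = f ` dom_chart c"
      using mat by (simp add: matching_def)
    have "matching ?g d c"
      using mat gfc by (simp add: matching_def im image_image)
    with c d show "\<exists>c\<in>charts_at N q. \<exists>d\<in>charts_at M (?g q). matching ?g c d" by blast
  qed auto
qed


section \<open>Submanifolds\<close>

lemma atlas_submanifoldD:
  assumes "c \<in> atlas (submanifold X)"
  shows "openin (top_of_set X) (dom_chart c)" "inj_on (coord c) (dom_chart c)"
    "open (coord c ` dom_chart c)" "smooth_on (dom_chart c) (coord c)"
    "smooth_on (coord c ` dom_chart c) (param c)" "dom_chart c \<subseteq> X"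
  using assms by (auto simp: submanifold_def dest: openin_imp_subset)

text \<open>Stated for any relatively open \<open>U\<close>, not just a chart domain, because the
  quotient applies it to the set from which a deck transformation reaches a second chart.\<close>

lemma submanifold_transition:
  assumes c: "c \<in> atlas (submanifold X)" and p: "p \<in> dom_chart c" and d: "openin (top_of_set X) U" "p \<in> U"
  shows "\<exists>W. open W \<and> coord c p \<in> W \<and> W \<subseteq> coord c ` dom_chart c \<and> param c ` W \<subseteq> U"
proof -
  note c' = atlas_submanifoldD[OF c]
  obtain V where V: "open V" "U = X \<inter> V" using d(1) by (auto simp: openin_open)
  have im: "coord c p \<in> coord c ` dom_chart c" using p by blast
  have "param c (coord c p) \<in> V" using V d(2) param_coord[OF c'(2) p] by simp
  then obtain W where W: "open W" "coord c p \<in> W" "param c ` W \<subseteq> V"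
    using smooth_at_preimage[OF smooth_on_openD[OF c'(5,3) im] V(1)] by metis
  show ?thesis
  proof (intro exI[of _ "W \<inter> coord c ` dom_chart c"] conjI)
    show "param c ` (W \<inter> coord c ` dom_chart c) \<subseteq> U"
      using W(3) V(2) c'(6) param_in_dom[of _ c] by blast
  qed (use W im c'(3) in auto)
qed

lemma smooth_atlas_submanifold: "smooth_atlas (submanifold X)"
  unfolding smooth_atlas_def
proof (intro conjI allI impI ballI)
  fix p and c d :: "('a, 'b) chart"
  assume "c \<in> charts_at (submanifold X) p" and "d \<in> charts_at (submanifold X) p"
  then have c: "c \<in> atlas (submanifold X)" "p \<in> dom_chart c" and d: "d \<in> atlas (submanifold X)" "p \<in> dom_chart d"
    by (auto simp: charts_at_def)
  note d' = atlas_submanifoldD[OF d(1)] and c' = atlas_submanifoldD[OF c(1)]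
  obtain W where W: "open W" "coord c p \<in> W" "W \<subseteq> coord c ` dom_chart c" "param c ` W \<subseteq> dom_chart d"
    using submanifold_transition[OF c d'(1) d(2)] by blast
  then show "\<exists>W. open W \<and> coord c p \<in> W \<and> W \<subseteq> coord c ` dom_chart c \<and> param c ` W \<subseteq> dom_chart d" by blast
  have "smooth_on W (\<lambda>x. coord d (param c x))"
    by (rule smooth_on_compose[OF smooth_on_subset[OF c'(5) W(3)] d'(4) W(4)])
  then show "(\<lambda>x. coord d (param c x)) differentiable (at (coord c p))"
    using W by (intro smooth_at_imp_differentiable smooth_on_openD)
qed (auto simp: atlas_submanifoldD)

lemma submanifold_chart_restrict:
  assumes c: "c \<in> atlas (submanifold X)" and V: "open V"
  shows "(dom_chart c \<inter> V, coord c) \<in> atlas (submanifold X)"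
proof -
  note c' = atlas_submanifoldD[OF c]
  let ?c = "(dom_chart c \<inter> V, coord c)"
  have inj: "inj_on (coord c) (dom_chart c \<inter> V)" using c'(2) by (rule inj_on_subset) auto
  have par: "param ?c y = param c y" if "y \<in> coord c ` (dom_chart c \<inter> V)" for y
    using that param_coord[OF c'(2)] inj by (auto simp: param_def)
  have im: "coord c ` (dom_chart c \<inter> V) = coord c ` dom_chart c \<inter> param c -` V"
    using param_coord[OF c'(2)] by auto
  have "openin (top_of_set X) (dom_chart c \<inter> V)" 
    by (rule openin_Int_open[OF c'(1) V])
  moreover have "open (coord c ` (dom_chart c \<inter> V))"
    unfolding im using smooth_on_continuous_on[OF c'(5)] c'(3) V by (simp add: continuous_open_preimage)
  moreover have "smooth_on (dom_chart c \<inter> V) (coord c)"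
    by (rule smooth_on_subset[OF c'(4)]) auto
  moreover have "smooth_on (coord c ` (dom_chart c \<inter> V)) (param ?c)"
    by (rule smooth_on_cong[OF smooth_on_subset[OF c'(5)]]) (use par in auto)
  ultimately show ?thesis using inj by (simp add: submanifold_def)
qed

section \<open>Quotients that embed as submanifolds\<close>

text \<open>A surjection \<open>h\<close> with smooth local inverses and its kernel relation
  \<open>r\<close>, so that the quotient is a copy of \<open>Y\<close>. Charts are assumed only for
  \<open>X\<close>; those of \<open>Y\<close> are obtained by pushing forward along
  \<open>h\<close>.\<close>

locale smooth_covering =
  fixes X :: "'a::euclidean_space set" and Y :: "'b::euclidean_space set" and h :: "'a \<Rightarrow> 'b"
    and M :: "('a, 'e::euclidean_space) manifold" and N :: "('b, 'e) manifold"
    and r :: "('a \<times> 'a) set" and Q :: "('a set, 'e) manifold"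
  assumes M_eq: "M = submanifold X" and N_eq: "N = submanifold Y"
    and r_eq: "r = {(x, y). x \<in> X \<and> y \<in> X \<and> h x = h y}" and Q_eq: "Q = quotient_manifold r M"
    and surj: "h ` X = Y" and smooth: "smooth_on X h"
    and local_inverse: "x \<in> X \<Longrightarrow> \<exists>V W k. open V \<and> x \<in> V \<and> open W \<and> smooth_on (Y \<inter> W) k \<and>
      k ` (Y \<inter> W) \<subseteq> X \<and> (\<forall>z\<in>Y \<inter> W. h (k z) = z) \<and> (\<forall>y\<in>X \<inter> V. h y \<in> W \<and> k (h y) = y)"
    and charts: "x \<in> X \<Longrightarrow> charts_at M x \<noteq> {}"
begin

text \<open>A point of the quotient is a full preimage under \<open>h\<close>, so this is the
  inverse of the bijection induced by \<open>h\<close>, and it will be the contactomorphism.\<close>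

definition fibre :: "'b \<Rightarrow> 'a set" where
  "fibre z = {x \<in> X. h x = z}"

lemma points_simps: "points M = X" "points N = Y" "points Q = fibre ` Y"
proof -
  have "points Q = (\<lambda>x. r `` {x}) ` X"
    by (auto simp: Q_eq quotient_manifold_def quotient_def M_eq submanifold_def)
  also have "\<dots> = (\<lambda>x. fibre (h x)) ` X"
    by (rule image_cong) (auto simp: r_eq fibre_def)
  finally show "points Q = fibre ` Y" by (simp add: image_image flip: surj)
qed (simp_all add: M_eq N_eq submanifold_def)

lemma quotient_proj_eq: "x \<in> X \<Longrightarrow> quotient_proj r x = fibre (h x)"
  by (auto simp: quotient_proj_def r_eq fibre_def)

lemma fibre_eq_iff: "z \<in> Y \<Longrightarrow> fibre z = fibre w \<longleftrightarrow> z = w"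
  unfolding fibre_def surj[symmetric] by auto

lemma quotient_proj_eq_iff: "x \<in> X \<Longrightarrow> y \<in> X \<Longrightarrow> quotient_proj r x = quotient_proj r y \<longleftrightarrow> h x = h y"
  using surj by (auto simp: quotient_proj_eq fibre_eq_iff)

lemmas atlas_M = atlas_submanifoldD[of c X for c :: "('a, 'e) chart", folded M_eq]

definition quotient_chart :: "('a, 'e) chart \<Rightarrow> ('a set, 'e) chart" where
  "quotient_chart c = (quotient_proj r ` dom_chart c,
     \<lambda>q. coord c (inv_into (dom_chart c) (quotient_proj r) q))"

lemma atlas_Q:
  "atlas Q = quotient_chart ` {c \<in> atlas M. inj_on (quotient_proj r) (dom_chart c)}"
  by (auto simp: Q_eq quotient_manifold_def quotient_chart_def)

lemma matching_quotient_chart: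
  "inj_on (quotient_proj r) (dom_chart c) \<Longrightarrow> matching (quotient_proj r) c (quotient_chart c)"
  by (simp add: matching_def quotient_chart_def)

lemma inj_on_quotient_chart:
  assumes "c \<in> atlas M" "inj_on (quotient_proj r) (dom_chart c)"
  shows "inj_on (coord (quotient_chart c)) (dom_chart (quotient_chart c))"
  using assms atlas_M(2)[OF assms(1)] by (auto simp: quotient_chart_def inj_on_def)

text \<open>A chart of \<open>X\<close> around \<open>x\<close>, shrunk until \<open>k\<close>
  inverts \<open>h\<close> on it, is pushed forward along \<open>h\<close> and along the projection.
  In the three resulting charts \<open>h\<close>, \<open>fibre\<close> and the projection are all
  the identity.\<close>

lemma matching_charts:
  assumes x: "x \<in> X"
  obtains c d e where "c \<in> charts_at M x" "d \<in> charts_at N (h x)" "e \<in> charts_at Q (fibre (h x))"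
    "dom_chart c \<subseteq> X" "dom_chart d \<subseteq> Y"
    "matching h c d" "matching fibre d e" "matching (quotient_proj r) c e"
proof -
  obtain V W k where V: "open V" "x \<in> V" and W: "open W" and k: "smooth_on (Y \<inter> W) k"
    "k ` (Y \<inter> W) \<subseteq> X" "\<forall>z\<in>Y \<inter> W. h (k z) = z" and kh: "\<forall>y\<in>X \<inter> V. h y \<in> W \<and> k (h y) = y"
    using local_inverse[OF x] by metis
  obtain c0 where c0: "c0 \<in> atlas M" "x \<in> dom_chart c0"
    using charts[OF x] by (auto simp: charts_at_def)
  define c where "c = (dom_chart c0 \<inter> V, coord c0)"
  define U where "U = dom_chart c"
  have c: "c \<in> atlas M" 
    using submanifold_chart_restrict[OF c0(1)[unfolded M_eq] V(1)] by (simp add: c_def M_eq)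
  have xU: "x \<in> U" using c0 V by (simp add: U_def c_def)
  have UX: "U \<subseteq> X" unfolding U_def by (rule atlas_M(6)[OF c])
  have UV: "U \<subseteq> V" by (simp add: U_def c_def)
  have kh': "h y \<in> Y" "h y \<in> W" "k (h y) = y" if "y \<in> U" for y
    using that UX UV kh surj by auto
  have inj: "inj_on h U" using kh'(3) by (rule inj_on_inverseI)
  define d :: "('b, 'e) chart" where "d = (h ` U, \<lambda>z. coord c (k z))"
  define e where "e = quotient_chart c"
  have mh: "matching h c d" by (auto simp: matching_def d_def U_def[symmetric] kh')
  have injd: "inj_on (coord d) (dom_chart d)"
    using atlas_M(2)[OF c] kh' by (auto simp: d_def inj_on_def U_def[symmetric])
  have "d \<in> atlas N"
  proof -
    obtain V' where V': "open V'" "U = X \<inter> V'"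
      using atlas_M(1)[OF c] by (auto simp: U_def openin_open)
    \<comment> \<open>Openness of an image under \<open>h\<close> is turned into openness of a
      preimage under the continuous \<open>k\<close>.\<close>
    have "h ` U = (Y \<inter> W) \<inter> k -` (V \<inter> V')"
    proof
      show "h ` U \<subseteq> (Y \<inter> W) \<inter> k -` (V \<inter> V')" using kh' UV V'(2) by auto
      show "(Y \<inter> W) \<inter> k -` (V \<inter> V') \<subseteq> h ` U"
      proof
        fix z assume z: "z \<in> (Y \<inter> W) \<inter> k -` (V \<inter> V')"
        then have "k z \<in> U" "h (k z) = z" using k V'(2) by auto
        then show "z \<in> h ` U" by force
      qed
    qed
    moreover have "openin (top_of_set (Y \<inter> W)) ((Y \<inter> W) \<inter> k -` (V \<inter> V'))"
      using smooth_on_continuous_on[OF k(1)] open_Int[OF V(1) V'(1)] by (rule continuous_openin_preimage_gen)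
    ultimately have "openin (top_of_set Y) (h ` U)"
      using W openin_trans openin_open_Int by metis
    moreover have "coord d ` (h ` U) = coord c ` U"
      using matching_image[OF mh] by (simp add: d_def U_def)
    moreover have "smooth_on (h ` U) (coord d)"
      unfolding d_def snd_conv
      by (rule smooth_on_compose[OF smooth_on_subset[OF k(1)] atlas_M(4)[OF c]])
         (use kh' in \<open>auto simp: U_def[symmetric]\<close>)
    moreover have "smooth_on (coord c ` U) (param d)"
    proof (rule smooth_on_cong)
      show "smooth_on (coord c ` U) (\<lambda>y. h (param c y))"
        using smooth_on_compose[OF atlas_M(5)[OF c] smooth_on_subset[OF smooth UX]]
        by (force simp: U_def intro: param_in_dom)
      show "h (param c y) = param d y" if "y \<in> coord c ` U" for y
        using matching_param[OF mh injd] that by (simp add: U_def)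
    qed
    ultimately show ?thesis
      using injd atlas_M(3)[OF c] by (simp add: N_eq submanifold_def d_def U_def[symmetric])
  qed
  have injp: "inj_on (quotient_proj r) U"
    using inj UX by (auto simp: inj_on_def quotient_proj_eq_iff subset_iff)
  have eq: "quotient_proj r y = fibre (h y)" if "y \<in> U" for y
    using that UX by (auto simp: quotient_proj_eq)
  have me: "matching (quotient_proj r) c e"
    unfolding e_def by (rule matching_quotient_chart) (use injp in \<open>simp add: U_def\<close>)
  have "matching fibre d e"
    using me kh'(3) unfolding matching_def
    by (auto simp: d_def U_def[symmetric] eq image_image)
  moreover have "e \<in> charts_at Q (fibre (h x))"
  proof -
    have "e \<in> atlas Q" using c injp by (simp add: atlas_Q e_def U_def)
    moreover have "fibre (h x) \<in> dom_chart e"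
      using me imageI[OF xU, of "quotient_proj r"] eq[OF xU] by (simp add: matching_def U_def)
    ultimately show ?thesis by (simp add: charts_at_def)
  qed
  moreover have "c \<in> charts_at M x" using c xU by (simp add: charts_at_def U_def)
  moreover have "d \<in> charts_at N (h x)" using \<open>d \<in> atlas N\<close> xU by (simp add: charts_at_def d_def)
  moreover have "dom_chart d \<subseteq> Y" using kh'(1) by (auto simp: d_def)
  ultimately show thesis
    using that mh me UX U_def by blast
qed

lemma smooth_atlas_M: "smooth_atlas M" and smooth_atlas_N: "smooth_atlas N"
  by (simp_all add: M_eq N_eq smooth_atlas_submanifold)

text \<open>Two charts around one point of the quotient may come from different sheets:
  \<open>x1\<close> and \<open>x2\<close> lie in one fibre but need not be close. With
  \<open>k\<close> the local inverse of \<open>h\<close> at \<open>x2\<close>, the composite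
  \<open>k o h\<close> carries the sheet at \<open>x1\<close> to the one at \<open>x2\<close>; it
  plays the part of a deck transformation, and its smoothness gives that of the transition
  map.\<close>

lemma smooth_atlas_Q: "smooth_atlas Q"
  unfolding smooth_atlas_def
proof (intro conjI allI impI ballI)
  fix c assume "c \<in> atlas Q"
  then obtain c1 where c1: "c1 \<in> atlas M" "inj_on (quotient_proj r) (dom_chart c1)" "c = quotient_chart c1"
    by (auto simp: atlas_Q)
  show "inj_on (coord c) (dom_chart c)"
    using inj_on_quotient_chart c1 by simp
  show "open (coord c ` dom_chart c)"
    unfolding c1(3) matching_image[OF matching_quotient_chart[OF c1(2)]] by (rule atlas_M(3)[OF c1(1)])
next
  fix q c d assume "c \<in> charts_at Q q" "d \<in> charts_at Q q"
  then obtain c1 d1 where c1: "c1 \<in> atlas M" "inj_on (quotient_proj r) (dom_chart c1)" "c = quotient_chart c1"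
    "q \<in> dom_chart c"
    and d1: "d1 \<in> atlas M" "inj_on (quotient_proj r) (dom_chart d1)" "d = quotient_chart d1" "q \<in> dom_chart d"
    by (auto simp: charts_at_def atlas_Q)
  note mc = matching_quotient_chart[OF c1(2), folded c1(3)]
    and md = matching_quotient_chart[OF d1(2), folded d1(3)]
  obtain x1 where x1: "x1 \<in> dom_chart c1" "quotient_proj r x1 = q"
    using c1(4) mc unfolding matching_def by (metis imageE)
  obtain x2 where x2: "x2 \<in> dom_chart d1" "quotient_proj r x2 = q"
    using d1(4) md unfolding matching_def by (metis imageE)
  have X: "dom_chart c1 \<subseteq> X" "dom_chart d1 \<subseteq> X" using atlas_M(6) c1(1) d1(1) by auto
  have x1X: "x1 \<in> X" and x2X: "x2 \<in> X" using x1 x2 X by auto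
  have hx: "h x1 = h x2" using quotient_proj_eq_iff[OF x1X x2X] x1 x2 by simp
  obtain V W k where V: "open V" "x2 \<in> V" and W: "open W" and k: "smooth_on (Y \<inter> W) k"
    "k ` (Y \<inter> W) \<subseteq> X" "\<forall>z\<in>Y \<inter> W. h (k z) = z" and kh: "\<forall>y\<in>X \<inter> V. h y \<in> W \<and> k (h y) = y"
    using local_inverse[OF x2X] by metis
  define B where "B = X \<inter> h -` W"
  have h_B: "h ` B \<subseteq> Y \<inter> W" using surj by (auto simp: B_def)
  have kh_smooth: "smooth_on B (\<lambda>y. k (h y))"
    by (rule smooth_on_compose[OF smooth_on_subset[OF smooth] k(1) h_B]) (simp add: B_def)
  have kh_X: "(\<lambda>y. k (h y)) ` B \<subseteq> X" using h_B k(2) by blast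
  obtain V' where V': "open V'" "dom_chart d1 = X \<inter> V'"
    using atlas_M(1)[OF d1(1)] by (auto simp: openin_open)
  \<comment> \<open>The points that \<open>k o h\<close> sends into the domain of \<open>d1\<close>.
    It contains \<open>x1\<close>, since \<open>k (h x1) = k (h x2) = x2\<close>.\<close>
  define A where "A = B \<inter> (\<lambda>y. k (h y)) -` V'"
  have "openin (top_of_set X) B"
    unfolding B_def using smooth_on_continuous_on[OF smooth] W by (rule continuous_openin_preimage_gen)
  moreover have "openin (top_of_set B) A"
    unfolding A_def using smooth_on_continuous_on[OF kh_smooth] V'(1) by (rule continuous_openin_preimage_gen)
  ultimately have A: "openin (top_of_set X) A" by (rule openin_trans[rotated])
  have "x1 \<in> A"
    using x1X x2X x2(1) V kh hx V'(2) by (simp add: A_def B_def)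
  then obtain S where S: "open S" "coord c1 x1 \<in> S" "S \<subseteq> coord c1 ` dom_chart c1" "param c1 ` S \<subseteq> A"
    using submanifold_transition[of c1 X x1 A] c1(1) x1(1) A by (auto simp: M_eq)
  have cq: "coord c q = coord c1 x1" using mc x1 by (auto simp: matching_def)
  have par: "param c y = quotient_proj r (k (h (param c1 y)))" "k (h (param c1 y)) \<in> dom_chart d1"
    if y: "y \<in> S" for y
  proof -
    have p: "param c1 y \<in> A" "y \<in> coord c1 ` dom_chart c1" using y S by auto
    then have "param c1 y \<in> B" by (simp add: A_def)
    moreover from this have "h (param c1 y) \<in> Y \<inter> W" using h_B by blast
    ultimately have 1: "k (h (param c1 y)) \<in> X" "h (k (h (param c1 y))) = h (param c1 y)" "param c1 y \<in> X"
      using k by (auto simp: B_def)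
    have "param c y = quotient_proj r (param c1 y)"
      using matching_param[OF mc _ p(2)] inj_on_quotient_chart[OF c1(1,2)] c1(3) by simp
    with 1 show "param c y = quotient_proj r (k (h (param c1 y)))"
      by (simp add: quotient_proj_eq)
    show "k (h (param c1 y)) \<in> dom_chart d1" using p 1 V'(2) by (auto simp: A_def)
  qed
  have "S \<subseteq> coord c ` dom_chart c" using S(3) matching_image[OF mc] by simp
  moreover have "param c ` S \<subseteq> dom_chart d" using par md by (auto simp: matching_def)
  ultimately show "\<exists>W. open W \<and> coord c q \<in> W \<and> W \<subseteq> coord c ` dom_chart c \<and> param c ` W \<subseteq> dom_chart d"
    using S(1,2) cq by metis
  have "smooth_on S (\<lambda>y. k (h (param c1 y)))"
    by (rule smooth_on_compose[OF smooth_on_subset[OF atlas_M(5)[OF c1(1)] S(3)] kh_smooth])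
       (use S(4) in \<open>auto simp: A_def\<close>)
  then have "smooth_on S (\<lambda>y. coord d1 (k (h (param c1 y))))"
    by (rule smooth_on_compose[OF _ atlas_M(4)[OF d1(1)]]) (use par in auto)
  then have "smooth_on S (\<lambda>y. coord d (param c y))"
    by (rule smooth_on_cong) (use par md in \<open>simp add: matching_def\<close>)
  then show "(\<lambda>y. coord d (param c y)) differentiable (at (coord c q))"
    unfolding cq by (rule smooth_at_imp_differentiable[OF smooth_on_openD[OF _ S(1,2)]])
qed

lemma diffeomorphism_fibre: "diffeomorphism N Q fibre"
proof (rule diffeomorphism_of_matching[OF _ _ smooth_atlas_N smooth_atlas_Q])
  show "bij_betw fibre (points N) (points Q)"
    by (auto simp: bij_betw_def points_simps inj_on_def fibre_eq_iff)
  fix z assume "z \<in> points N"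
  then obtain x where x: "x \<in> X" "z = h x" using surj by (auto simp: points_simps)
  show "\<exists>c\<in>charts_at N z. \<exists>d\<in>charts_at Q (fibre z). dom_chart c \<subseteq> points N \<and> matching fibre c d"
    by (rule matching_charts[OF x(1)]) (use x points_simps in blast)
qed

text \<open>The value of \<open>\<omega>\<close> on a lift of a tangent vector is determined by the value of \<open>\<alpha>\<close>, so the
  definite description is meaningful without an appeal to the invariance of \<open>\<omega>\<close>.\<close>

lemma induced_form_fibre:
  fixes \<omega> :: "'a \<Rightarrow> ('a, 'e) tangent \<Rightarrow> 'k::field"
  assumes conformal: "\<And>x v. x \<in> X \<Longrightarrow> v \<in> tangent_space M x \<Longrightarrow>
      \<alpha> (h x) (differential M N h x v) = D (h x) * \<omega> x v"
    and D: "\<And>z. z \<in> Y \<Longrightarrow> D z \<noteq> 0"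
    and z: "z \<in> Y" and u: "u \<in> tangent_space N z"
  shows "induced_form r M \<omega> (fibre z) (differential N Q fibre z u) = \<alpha> z u / D z"
  unfolding induced_form_def Q_eq[symmetric]
proof (rule the_equality)
  obtain x where x: "x \<in> X" "z = h x" using z surj by auto
  obtain c d e where c: "c \<in> charts_at M x" and d: "d \<in> charts_at N z" and e: "e \<in> charts_at Q (fibre z)"
    and m: "matching h c d" "matching fibre d e" "matching (quotient_proj r) c e"
    using matching_charts[OF x(1)] x(2) by metis
  define v where "v = tangent_of_chart M x c (u d)"
  have v: "v \<in> tangent_space M x" "v c = u d"
    unfolding v_def by (rule tangent_of_chart_in_tangent_space tangent_of_chart_self smooth_atlas_M c)+
  have "differential M N h x v = u"
    using differential_matching[OF smooth_atlas_M smooth_atlas_N c _ m(1) v(1)]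
      tangent_space_eq_tangent_of_chart[OF u d] v(2) d x(2) by simp
  then have "\<alpha> z u / D z = \<omega> x v"
    using conformal[OF x(1) v(1)] D[OF z] x(2) by simp
  moreover have "differential M Q (quotient_proj r) x v = differential N Q fibre z u"
    using differential_matching[OF smooth_atlas_M smooth_atlas_Q c _ m(3) v(1)]
      differential_matching[OF smooth_atlas_N smooth_atlas_Q d e m(2) u] v(2) e x
    by (simp add: quotient_proj_eq)
  ultimately show "\<exists>p\<in>points M. \<exists>v\<in>tangent_space M p. quotient_proj r p = fibre z \<and>
      differential M Q (quotient_proj r) p v = differential N Q fibre z u \<and> \<omega> p v = \<alpha> z u / D z"
    using x v(1) quotient_proj_eq[OF x(1)] points_simps by auto
next
  fix t assume "\<exists>p\<in>points M. \<exists>v\<in>tangent_space M p. quotient_proj r p = fibre z \<and>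
      differential M Q (quotient_proj r) p v = differential N Q fibre z u \<and> \<omega> p v = t"
  then obtain p v where p: "p \<in> X" "quotient_proj r p = fibre z" and v: "v \<in> tangent_space M p"
    and pv: "differential M Q (quotient_proj r) p v = differential N Q fibre z u" "\<omega> p v = t"
    by (auto simp: points_simps)
  have hp: "z = h p" using p z by (simp add: quotient_proj_eq fibre_eq_iff[of z "h p", symmetric])
  obtain c d e where c: "c \<in> charts_at M p" and d: "d \<in> charts_at N z" and e: "e \<in> charts_at Q (fibre z)"
    and m: "matching h c d" "matching fibre d e" "matching (quotient_proj r) c e"
    using matching_charts[OF p(1)] hp by metis
  have "tangent_of_chart Q (fibre z) e (v c) = tangent_of_chart Q (fibre z) e (u d)"
    using pv(1) differential_matching[OF smooth_atlas_M smooth_atlas_Q c _ m(3) v]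
      differential_matching[OF smooth_atlas_N smooth_atlas_Q d e m(2) u] e p(2) by simp
  then have "v c = u d" using tangent_of_chart_self[OF smooth_atlas_Q e] by metis
  then have "differential M N h p v = u"
    using differential_matching[OF smooth_atlas_M smooth_atlas_N c _ m(1) v]
      tangent_space_eq_tangent_of_chart[OF u d] d hp by simp
  then show "t = \<alpha> z u / D z"
    using conformal[OF p(1) v] D[OF z] hp pv(2) by simp
qed

text \<open>The induced form corresponds to \<open>\<alpha> / D\<close>, and a nonvanishing factor
  leaves the kernel unchanged. That the whole kernel is reached is seen by lifting a vector through
  matching charts.\<close>

theorem contactomorphic_quotient:
  fixes \<omega> :: "'a \<Rightarrow> ('a, 'e) tangent \<Rightarrow> 'k::field"
  assumes conformal: "\<And>x v. x \<in> X \<Longrightarrow> v \<in> tangent_space M x \<Longrightarrow>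
      \<alpha> (h x) (differential M N h x v) = D (h x) * \<omega> x v"
    and D: "\<And>z. z \<in> Y \<Longrightarrow> D z \<noteq> 0"
  shows "contactomorphic N (form_kernel N \<alpha>) Q (form_kernel Q (induced_form r M \<omega>))"
  unfolding contactomorphic_def
proof (intro exI[of _ fibre] conjI ballI diffeomorphism_fibre)
  fix z assume "z \<in> points N"
  then obtain x where x: "x \<in> X" "z = h x" and z: "z \<in> Y" using surj by (auto simp: points_simps)
  obtain c d e where d: "d \<in> charts_at N z" and e: "e \<in> charts_at Q (fibre z)" and m: "matching fibre d e"
    using matching_charts[OF x(1)] x(2) by metis
  note diff = differential_matching[OF smooth_atlas_N smooth_atlas_Q d e m]
  have form: "induced_form r M \<omega> (fibre z) (differential N Q fibre z u) = \<alpha> z u / D z"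
    if "u \<in> tangent_space N z" for u
    using conformal D z that by (rule induced_form_fibre)
  show "differential N Q fibre z ` form_kernel N \<alpha> z = form_kernel Q (induced_form r M \<omega>) (fibre z)"
  proof (intro equalityI subsetI)
    fix w assume "w \<in> differential N Q fibre z ` form_kernel N \<alpha> z"
    then show "w \<in> form_kernel Q (induced_form r M \<omega>) (fibre z)"
      using tangent_of_chart_in_tangent_space[OF smooth_atlas_Q e] diff form
      by (auto simp: form_kernel_def)
  next
    fix w assume w: "w \<in> form_kernel Q (induced_form r M \<omega>) (fibre z)"
    then have w': "w \<in> tangent_space Q (fibre z)" by (simp add: form_kernel_def)
    define u where "u = tangent_of_chart N z d (w e)"
    have u: "u \<in> tangent_space N z" "u d = w e"
      unfolding u_def by (rule tangent_of_chart_in_tangent_space tangent_of_chart_self smooth_atlas_N d)+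
    have "differential N Q fibre z u = w"
      using diff[OF u(1)] u(2) tangent_space_eq_tangent_of_chart[OF w' e] by simp
    moreover from this have "\<alpha> z u = 0"
      using form[OF u(1)] w D[OF z] by (simp add: form_kernel_def)
    ultimately show "w \<in> differential N Q fibre z ` form_kernel N \<alpha> z"
      using u(1) by (auto simp: form_kernel_def)
  qed
qed

end

section \<open>Charts of spheres and the standard form in ambient coordinates\<close>

text \<open>Orthogonal projection \<open>G\<close> of the open hemisphere around \<open>x\<close> to
  the hyperplane orthogonal to \<open>x\<close>, identified with the model space by a linear
  isometry. Its inverse \<open>P\<close> is the graph of \<open>sqrt (1 - |a|^2)\<close> over the
  open unit ball, where the radicand is positive and the root smooth.\<close>

lemma chart_of_sphere:
  fixes x :: "'a::euclidean_space"
  assumes x: "x \<in> sphere 0 1" and dim: "DIM('a) = Suc DIM('e::euclidean_space)"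
  shows "charts_at (submanifold (sphere 0 1) :: ('a, 'e) manifold) x \<noteq> {}"
proof -
  define H where "H = {y. x \<bullet> y = 0}"
  have nx: "norm x = 1" and x0: "x \<noteq> 0" and xx: "x \<bullet> x = 1"
    using x by (auto simp: norm_eq_1)
  have sub: "subspace H" unfolding H_def by (rule subspace_hyperplane)
  have "dim (UNIV :: 'e set) = dim H"
    using dim_hyperplane[OF x0] dim by (simp add: H_def)
  then obtain f :: "'e \<Rightarrow> 'a" and g where f: "linear f" "f ` UNIV = H" and nf: "\<And>y. norm (f y) = norm y"
    and g: "linear g" "\<And>y. g (f y) = y" "\<And>z. z \<in> H \<Longrightarrow> f (g z) = z"
    using isometries_subspaces[OF subspace_UNIV sub] by (metis UNIV_I)
  have fH: "x \<bullet> f y = 0" for y using f(2) by (auto simp: H_def)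
  let ?D = "{y \<in> sphere 0 1. x \<bullet> y > 0}"
  define G where "G = (\<lambda>y. g (y - (x \<bullet> y) *\<^sub>R x))"
  define P where "P = (\<lambda>a. f a + sqrt (1 - (norm a)\<^sup>2) *\<^sub>R x)"
  have bf: "bounded_linear f" and bg: "bounded_linear g" using f g by (simp_all add: linear_linear)
  have GP: "G (P a) = a" for a
    by (simp add: G_def P_def inner_right_distrib fH xx g)
  have norm_sq: "(norm (f a + t *\<^sub>R x))\<^sup>2 = (norm a)\<^sup>2 + t\<^sup>2" for a t
    using norm_add_Pythagorean[of "f a" "t *\<^sub>R x"] fH
    by (simp add: orthogonal_def inner_commute nf nx)
  have PG: "P (G y) = y \<and> norm (G y) < 1" if y: "y \<in> ?D" for y
  proof -
    have "y - (x \<bullet> y) *\<^sub>R x \<in> H" by (simp add: H_def inner_diff_right xx)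
    then have fG: "f (G y) = y - (x \<bullet> y) *\<^sub>R x" by (simp add: G_def g)
    then have "f (G y) + (x \<bullet> y) *\<^sub>R x = y" by simp
    with norm_sq[of "G y" "x \<bullet> y"] y have *: "(norm (G y))\<^sup>2 + (x \<bullet> y)\<^sup>2 = 1" by simp
    then have "sqrt (1 - (norm (G y))\<^sup>2) = x \<bullet> y"
      using y by (intro real_sqrt_unique) auto
    moreover have "norm (G y) < 1"
    proof -
      have "(x \<bullet> y)\<^sup>2 > 0" using y by simp
      with * have "(norm (G y))\<^sup>2 < 1" by linarith
      then show ?thesis by (simp add: power_less_one_iff)
    qed
    ultimately show ?thesis using fG by (simp add: P_def)
  qed
  have PD: "P a \<in> ?D" if "a \<in> ball 0 1" for a
  proof -
    have a: "(norm a)\<^sup>2 < 1" using that by (simp add: power_less_one_iff)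
    then have "(norm (P a))\<^sup>2 = 1" by (simp add: P_def norm_sq)
    then have "norm (P a) = 1" using power2_eq_imp_eq[of "norm (P a)" 1] by simp
    moreover have "x \<bullet> P a > 0" using a by (simp add: P_def inner_right_distrib fH xx)
    ultimately show ?thesis by simp
  qed
  have im: "G ` ?D = ball 0 1"
  proof
    show "G ` ?D \<subseteq> ball 0 1" using PG by auto
    show "ball 0 1 \<subseteq> G ` ?D"
    proof
      fix a :: 'e assume "a \<in> ball 0 1"
      with PD have "P a \<in> ?D" by blast
      with GP[of a] show "a \<in> G ` ?D" by (metis imageI)
    qed
  qed
  have inj: "inj_on G ?D" using PG by (intro inj_on_inverseI[of _ P]) blast
  have par: "param (?D, G) a = P a" if "a \<in> ball 0 1" for a
    using inv_into_f_f[OF inj PD[OF that]] GP by (simp add: param_def)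
  have "openin (top_of_set (sphere 0 1)) ?D"
  proof -
    have "?D = sphere 0 1 \<inter> {y. x \<bullet> y > 0}" by auto
    then show ?thesis using open_halfspace_gt[of 0 x] by (metis openin_open_Int)
  qed
  moreover have "smooth_on ?D G"
    unfolding G_def
    by (intro smooth_onI smooth_at_linear[OF bg] smooth_at_diff smooth_at_id smooth_at_scaleR smooth_at_const
        smooth_at_inner)
  moreover have "smooth_on (G ` ?D) (param (?D, G))"
  proof (rule smooth_on_cong)
    show "smooth_on (G ` ?D) P"
      unfolding P_def im power2_norm_eq_inner
    proof (intro smooth_onI smooth_at_linear[OF bf] smooth_at_add smooth_at_diff smooth_at_id smooth_at_scaleR
        smooth_at_const smooth_at_sqrt smooth_at_inner)
      fix a :: 'e assume "a \<in> ball 0 1"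
      then have "(norm a)\<^sup>2 < 1" by (simp add: power_less_one_iff)
      then show "0 < 1 - a \<bullet> a" by (simp add: power2_norm_eq_inner)
    qed
  qed (use par im in simp)
  ultimately have "(?D, G) \<in> atlas (submanifold (sphere 0 1))"
    using inj im by (simp add: submanifold_def)
  moreover have "x \<in> ?D" using x xx by simp
  ultimately show ?thesis by (force simp: charts_at_def)
qed

text \<open>The value of the form at \<open>z\<close> on an ambient vector \<open>w\<close>, by
  \<open>\<i>/2 (a cnj b - cnj a b) = Im (cnj a b)\<close>.\<close>

definition std_pairing :: "complex^'n \<Rightarrow> complex^'n \<Rightarrow> complex" where
  "std_pairing z w = of_real (\<Sum>j\<in>UNIV. Im (cnj (z $ j) * w $ j))"

lemma std_form_eq_pairing:
  fixes M :: "(complex^'n, 'e::euclidean_space) manifold"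
  assumes M: "smooth_atlas M" and c: "c \<in> charts_at M p" and v: "v \<in> tangent_space M p"
    and par: "(param c has_derivative D) (at (coord c p))"
  shows "std_form M p v = std_pairing p (D (v c))"
proof -
  have 1: "((\<lambda>x. param c x $ j) has_derivative (\<lambda>w. D w $ j)) (at (coord c p))" for j
    by (rule bounded_linear.has_derivative[OF bounded_linear_vec_nth par])
  have 2: "((\<lambda>x. cnj (param c x $ j)) has_derivative (\<lambda>w. cnj (D w $ j))) (at (coord c p))" for j
    by (rule bounded_linear.has_derivative[OF bounded_linear_cnj 1])
  have e1: "fun_differential M (\<lambda>y. y $ j) p v = D (v c) $ j" for j
    using fun_differential_eq[OF M c v differentiableI[OF 1]] fun_cong[OF frechet_derivative_at[OF 1], of "v c" j]
    by simp
  have e2: "fun_differential M (\<lambda>y. cnj (y $ j)) p v = cnj (D (v c) $ j)" for j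
    using fun_differential_eq[OF M c v differentiableI[OF 2]] fun_cong[OF frechet_derivative_at[OF 2], of "v c" j]
    by simp
  have im: "\<i> / 2 * (a * cnj b - cnj a * b) = of_real (Im (cnj a * b))" for a b
    by (auto simp: complex_eq_iff field_simps)
  show ?thesis
    unfolding std_form_def e1 e2 std_pairing_def sum_distrib_left im of_real_sum ..
qed

text \<open>Reduces conformality to ambient calculus: \<open>w\<close> is the ambient velocity of
  \<open>v\<close>, and because the charts match, the image vector has as ambient velocity the
  derivative of \<open>h\<close> applied to \<open>w\<close>.\<close>

lemma std_form_differential:
  fixes h :: "complex^'n \<Rightarrow> complex^'m"
  assumes cov: "smooth_covering X Y h M N r Q" and x: "x \<in> X" and v: "v \<in> tangent_space M x"
    and h: "h differentiable (at x)"
  obtains w where "std_form M x v = std_pairing x w"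
    "std_form N (h x) (differential M N h x v) = std_pairing (h x) (frechet_derivative h (at x) w)"
proof -
  interpret smooth_covering X Y h M N r Q by fact
  obtain c d where c: "c \<in> charts_at M x" and d: "d \<in> charts_at N (h x)" and m: "matching h c d"
    using matching_charts[OF x] by metis
  note c' = smooth_atlas_chart[OF smooth_atlas_M c] and d' = smooth_atlas_chart[OF smooth_atlas_N d]
  have cX: "c \<in> atlas M" using c by (simp add: charts_at_def)
  have cx: "coord c x \<in> coord c ` dom_chart c" using c'(3) by blast
  have eq: "coord d (h x) = coord c x" using m c'(3) by (simp add: matching_def)
  have "param c differentiable (at (coord c x))"
    by (rule smooth_at_imp_differentiable[OF smooth_on_openD[OF atlas_M(5)[OF cX] c'(2) cx]])
  then obtain D where D: "(param c has_derivative D) (at (coord c x))"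
    by (auto simp: differentiable_def)
  let ?h' = "frechet_derivative h (at x)"
  have "(h has_derivative ?h') (at (param c (coord c x)))"
    using h c'(4) by (simp add: frechet_derivative_works)
  from has_derivative_compose[OF D this]
  have "(param d has_derivative (\<lambda>w. ?h' (D w))) (at (coord d (h x)))"
    unfolding eq
    by (rule has_derivative_transform_within_open[OF _ c'(2) cx]) (rule matching_param[OF m d'(1)])
  moreover have "differential M N h x v \<in> tangent_space N (h x)" "differential M N h x v d = v c"
    unfolding differential_matching[OF smooth_atlas_M smooth_atlas_N c d m v]
    by (rule tangent_of_chart_in_tangent_space tangent_of_chart_self smooth_atlas_N d)+
  ultimately have "std_form N (h x) (differential M N h x v) = std_pairing (h x) (?h' (D (v c)))"
    using std_form_eq_pairing[OF smooth_atlas_N d] by metis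
  with std_form_eq_pairing[OF smooth_atlas_M c v D] show thesis by (rule that)
qed

section \<open>The modulus of the first coordinate\<close>

definition conformal_factor :: "nat \<Rightarrow> real \<Rightarrow> real" where
  "conformal_factor n p = (n + 1) - (real n - 1) * p"

text \<open>The cofactor of \<open>p\<close> in \<open>4 (p + (n+1) q1) (p + (n+1) q2)\<close>: with
  \<open>q1 + q2 = 1 - p\<close> and \<open>4 q1 q2 = p^(n+1)\<close> this product is
  \<open>4 p^2 + 4 (n+1) p (1-p) + (n+1)^2 p^(n+1)\<close>. Splitting off \<open>p\<close> leaves a
  factor that is positive on [0, 1], which keeps everything regular at \<open>p = 0\<close>.\<close>

definition level_poly :: "nat \<Rightarrow> real \<Rightarrow> real" where
  "level_poly n p = 4 * (n + 1) - 4 * n * p + (n + 1)\<^sup>2 * p ^ n"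

definition level_fun :: "nat \<Rightarrow> real \<Rightarrow> real" where
  "level_fun n p = p * level_poly n p / (conformal_factor n p)\<^sup>2"

text \<open>Slightly more than \<open>[0, 1)\<close>, so that the inverse is smooth up to the value \<open>0\<close>, which is
  attained on the coordinate axes.\<close>

definition level_dom :: "nat \<Rightarrow> real set" where
  "level_dom n = {- 1 / (n + 1)\<^sup>2 <..< 1}"

definition level_inv :: "nat \<Rightarrow> real \<Rightarrow> real" where
  "level_inv n = inv_into (level_dom n) (level_fun n)"

lemma conformal_factor_pos:
  assumes "n \<ge> 1" "p \<le> 1"
  shows "conformal_factor n p > 0"
proof -
  have "(real n - 1) * p \<le> (real n - 1) * 1"
    using assms by (intro mult_left_mono) auto
  then show ?thesis by (simp add: conformal_factor_def)
qed

lemma level_poly_ge: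
  assumes "0 \<le> p" "p \<le> 1"
  shows "level_poly n p \<ge> 4"
proof -
  have "real n * p \<le> real n" using assms by (simp add: mult_left_le)
  moreover have "(real n + 1)\<^sup>2 * p ^ n \<ge> 0" using assms by simp
  ultimately show ?thesis by (simp add: level_poly_def)
qed

text \<open>The derivative of \<open>level_fun\<close> after one factor
  \<open>conformal_factor\<close> has cancelled, grouped so that its sign can be estimated.\<close>

definition level_deriv :: "nat \<Rightarrow> real \<Rightarrow> real" where
  "level_deriv n p = (n + 1)\<^sup>2 * (4 * (1 - p) + p ^ n * ((n + 1)\<^sup>2 - (real n - 1)\<^sup>2 * p)) / conformal_factor n p ^ 3"

lemma level_fun_has_derivative:
  assumes "n \<ge> 1" "p \<le> 1"
  shows "(level_fun n has_real_derivative level_deriv n p) (at p)"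
proof -
  let ?D = "conformal_factor n p"
  have D: "?D > 0" by (rule conformal_factor_pos[OF assms])
  have d1: "(conformal_factor n has_real_derivative - (real n - 1)) (at p)"
    unfolding conformal_factor_def[abs_def] by (auto intro!: derivative_eq_intros)
  have "((\<lambda>p. p * level_poly n p) has_real_derivative
      4 * (real n + 1) - 8 * n * p + (real n + 1) ^ 3 * p ^ n) (at p)"
  proof -
    have "((\<lambda>p. 4 * (real n + 1) * p - 4 * n * p\<^sup>2 + (real n + 1)\<^sup>2 * p ^ Suc n) has_real_derivative
        4 * (real n + 1) - 8 * n * p + (real n + 1) ^ 3 * p ^ n) (at p)"
      by (rule DERIV_cong[OF DERIV_add[OF DERIV_diff[OF DERIV_cmult[OF DERIV_ident] DERIV_cmult[OF DERIV_pow]]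
          DERIV_cmult[OF DERIV_pow]]])
         (simp add: power3_eq_cube power2_eq_square algebra_simps)
    also have "(\<lambda>p::real. 4 * (real n + 1) * p - 4 * n * p\<^sup>2 + (real n + 1)\<^sup>2 * p ^ Suc n) = (\<lambda>p. p * level_poly n p)"
      by (auto simp: level_poly_def fun_eq_iff algebra_simps power2_eq_square)
    finally show ?thesis .
  qed
  from DERIV_divide[OF this DERIV_power[OF d1, of 2]] D
  have "(level_fun n has_real_derivative
      ((4 * (real n + 1) - 8 * n * p + (real n + 1) ^ 3 * p ^ n) * ?D\<^sup>2
        - p * level_poly n p * (2 * (?D * - (real n - 1)))) / (?D\<^sup>2 * ?D\<^sup>2)) (at p)"
    by (simp add: level_fun_def[abs_def] mult.commute mult.left_commute)
  moreover have "((4 * (real n + 1) - 8 * n * p + (real n + 1) ^ 3 * p ^ n) * ?D\<^sup>2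
        - p * level_poly n p * (2 * (?D * - (real n - 1)))) / (?D\<^sup>2 * ?D\<^sup>2) = level_deriv n p"
  proof -
    have "(4 * (real n + 1) - 8 * n * p + (real n + 1) ^ 3 * p ^ n) * ?D
        + p * level_poly n p * (2 * (real n - 1)) =
        (real n + 1)\<^sup>2 * (4 * (1 - p) + p ^ n * ((real n + 1)\<^sup>2 - (real n - 1)\<^sup>2 * p))"
      unfolding level_poly_def conformal_factor_def of_nat_add of_nat_mult of_nat_numeral of_nat_1
      by (simp add: power2_eq_square power3_eq_cube algebra_simps)
    then have "level_deriv n p = ((4 * (real n + 1) - 8 * n * p + (real n + 1) ^ 3 * p ^ n) * ?D
        + p * level_poly n p * (2 * (real n - 1))) / ?D ^ 3"
      by (simp add: level_deriv_def add.commute)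
    also have "\<dots> = ((4 * (real n + 1) - 8 * n * p + (real n + 1) ^ 3 * p ^ n) * ?D\<^sup>2
        - p * level_poly n p * (2 * (?D * - (real n - 1)))) / (?D\<^sup>2 * ?D\<^sup>2)"
      using D by (simp add: field_simps power2_eq_square power3_eq_cube)
    finally show ?thesis by simp
  qed
  ultimately show ?thesis by simp
qed

text \<open>For \<open>p >= 0\<close> one has \<open>(n-1)^2 p <= (n+1)^2\<close>, and
  \<open>4 (1-p)\<close> is positive. For negative \<open>p\<close> the term \<open>4 (1-p)\<close>
  exceeds 4, while the other has modulus at most \<open>2 (n+1)^2 |p|\<close>, which is below 2 by
  the choice of the left end of \<open>level_dom\<close>.\<close>

lemma level_deriv_pos:
  assumes "n \<ge> 1" "p \<in> level_dom n"
  shows "level_deriv n p > 0"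
proof -
  let ?N = "real n + 1"
  have p: "- 1 / ?N\<^sup>2 < p" "p < 1" using assms by (auto simp: level_dom_def add.commute)
  have n: "real n \<ge> 1" using assms by simp
  have "4 * (1 - p) + p ^ n * (?N\<^sup>2 - (real n - 1)\<^sup>2 * p) > 0"
  proof (cases "p \<ge> 0")
    case True
    have "(real n - 1)\<^sup>2 * p \<le> ?N\<^sup>2 * 1"
      using True p n by (intro mult_mono power_mono) auto
    with True p show ?thesis by (simp add: add_pos_nonneg)
  next
    case False
    then have ap: "\<bar>p\<bar> < 1 / ?N\<^sup>2" using p by simp
    have N1: "?N\<^sup>2 \<ge> 1" using n by simp
    then have ap1: "\<bar>p\<bar> \<le> 1" using ap by (smt (verit) divide_le_eq_1)
    have "\<bar>p ^ n\<bar> \<le> \<bar>p\<bar> ^ 1"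
      unfolding power_abs using ap1 assms(1) by (intro power_decreasing) auto
    moreover have "\<bar>?N\<^sup>2 - (real n - 1)\<^sup>2 * p\<bar> \<le> 2 * ?N\<^sup>2"
    proof -
      have "(real n - 1)\<^sup>2 * \<bar>p\<bar> \<le> ?N\<^sup>2 * 1"
        using ap1 n by (intro mult_mono power_mono) auto
      then have "\<bar>(real n - 1)\<^sup>2 * p\<bar> \<le> ?N\<^sup>2" by (simp add: abs_mult)
      then show ?thesis using N1 by linarith
    qed
    ultimately have "\<bar>p ^ n * (?N\<^sup>2 - (real n - 1)\<^sup>2 * p)\<bar> \<le> \<bar>p\<bar> * (2 * ?N\<^sup>2)"
      unfolding abs_mult by (intro mult_mono) auto
    also have "\<dots> < 2" using ap N1 by (simp add: field_simps)
    finally have "- 2 < p ^ n * (?N\<^sup>2 - (real n - 1)\<^sup>2 * p)" by (simp add: abs_less_iff)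
    moreover have "2 < 4 * (1 - p)" using False by simp
    ultimately show ?thesis by linarith
  qed
  then show ?thesis
    unfolding level_deriv_def using conformal_factor_pos[OF assms(1), of p] p n
    by (intro divide_pos_pos mult_pos_pos) (auto simp: add.commute)
qed

lemma level_fun_inj: "n \<ge> 1 \<Longrightarrow> inj_on (level_fun n) (level_dom n)"
proof (rule strict_mono_on_imp_inj_on[OF strict_mono_onI])
  fix a b assume "n \<ge> 1" and ab: "a \<in> level_dom n" "b \<in> level_dom n" "a < b"
  show "level_fun n a < level_fun n b"
  proof (rule DERIV_pos_imp_increasing[OF ab(3)])
    fix x assume "a \<le> x" "x \<le> b"
    then have "x \<in> level_dom n" using ab by (auto simp: level_dom_def)
    then show "\<exists>y. (level_fun n has_real_derivative y) (at x) \<and> y > 0"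
      using level_fun_has_derivative[OF \<open>n \<ge> 1\<close>, of x] level_deriv_pos[OF \<open>n \<ge> 1\<close>, of x]
      by (auto simp: level_dom_def)
  qed
qed

lemma level_domI:
  assumes "0 \<le> p" "p < 1"
  shows "p \<in> level_dom n"
proof -
  have "- 1 / (real n + 1)\<^sup>2 < 0" by (simp add: field_simps)
  with assms(1) have "- 1 / (real n + 1)\<^sup>2 < p" by linarith
  with assms(2) show ?thesis by (simp add: level_dom_def add.commute)
qed

lemma level_inv_level_fun:
  assumes "n \<ge> 1" "0 \<le> p" "p < 1"
  shows "level_inv n (level_fun n p) = p"
  unfolding level_inv_def using assms by (intro inv_into_f_f level_fun_inj level_domI)

text \<open>Intermediate values on [0, 1]: \<open>level_fun\<close> is 0 at 0 and
  \<open>1 + (n+1)^2 / 4\<close> at 1, which exceeds every admissible \<open>w\<close>. Hence the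
  solution stays below 1, inside the open interval on which the inverse function is smooth.\<close>

lemma level_inv:
  assumes n: "n \<ge> 1" and w: "0 \<le> w" "w \<le> 1"
  shows "0 \<le> level_inv n w" "level_inv n w < 1" "level_fun n (level_inv n w) = w" "smooth_at (level_inv n) w"
proof -
  have f1: "level_fun n 1 > 1"
    by (simp add: level_fun_def level_poly_def conformal_factor_def power2_eq_square add_pos_nonneg)
  have "continuous_on {0..1} (level_fun n)"
    using level_fun_has_derivative[OF n] by (intro continuous_at_imp_continuous_on ballI DERIV_isCont) auto
  then obtain p where p: "0 \<le> p" "p \<le> 1" "level_fun n p = w"
    using IVT'[of "level_fun n" 0 w 1] w f1 by (auto simp: level_fun_def)
  have "p \<noteq> 1" using p w f1 by auto
  with p have p1: "p < 1" by simp
  have inv: "level_inv n w = p" using level_inv_level_fun[OF n p(1) p1] p(3) by simp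
  show "0 \<le> level_inv n w" "level_inv n w < 1" "level_fun n (level_inv n w) = w"
    using inv p p1 by auto
  show "smooth_at (level_inv n) w"
    unfolding level_inv_def
  proof (rule smooth_at_inverse_function[where f' = "level_deriv n", OF _ level_fun_inj[OF n]])
    show "open (level_dom n)" by (simp add: level_dom_def)
    fix x assume x: "x \<in> level_dom n"
    then have x1: "x \<le> 1" by (simp add: level_dom_def)
    show "(level_fun n has_real_derivative level_deriv n x) (at x)"
      by (rule level_fun_has_derivative[OF n x1])
    show "level_deriv n x \<noteq> 0" using level_deriv_pos[OF n x] by simp
    show "smooth_at (level_deriv n) x"
      unfolding level_deriv_def[abs_def] conformal_factor_def
      by (intro smooth_at_divide_real smooth_at_mult smooth_at_add smooth_at_diff smooth_at_power smooth_at_const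
          smooth_at_id) (use conformal_factor_pos[OF n x1] in \<open>simp add: conformal_factor_def\<close>)
  next
    show "w \<in> level_fun n ` level_dom n" using level_domI[OF p(1) p1] p(3) by blast
  qed
qed

section \<open>The radial coordinates\<close>

text \<open>Forced by \<open>p = k^2 S T\<close>: with \<open>E = level_poly n p\<close> the level
  equation reads \<open>p E = 4 S T D^2\<close>, so \<open>k^2 = 4 D^2 / E\<close>. The factor
  \<open>p\<close> has cancelled, so \<open>k\<close> is positive also at
  \<open>p = 0\<close>.\<close>

definition link_k :: "nat \<Rightarrow> real \<Rightarrow> real" where
  "link_k n p = 2 * conformal_factor n p / sqrt (level_poly n p)"

text \<open>The equation \<open>D S = p + (n + 1) q\<^sub>1\<close> and the relation \<open>4 q\<^sub>1 q\<^sub>2 = p\<^sup>n\<^sup>+\<^sup>1\<close> each express the square of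
  the radial factor as a quotient, but the first one is \<open>0 / 0\<close> at \<open>S = 0\<close> and the second one at
  \<open>T = 0\<close>.  Adding numerators and denominators removes both singularities.\<close>

definition link_r :: "nat \<Rightarrow> real \<Rightarrow> real \<Rightarrow> real \<Rightarrow> real" where
  "link_r n p S T = sqrt
    (((conformal_factor n p - (link_k n p)\<^sup>2 * T) / (n + 1) + link_k n p ^ (2 * (n + 1)) * T ^ n) /
     (S ^ n + 4 * (conformal_factor n p - (link_k n p)\<^sup>2 * S) / (n + 1)))"

lemma link_k_sq:
  assumes "n \<ge> 1" "0 \<le> p" "p < 1"
  shows "link_k n p > 0" "(link_k n p)\<^sup>2 = 4 * (conformal_factor n p)\<^sup>2 / level_poly n p"
proof -
  have E: "level_poly n p \<ge> 4" using assms by (intro level_poly_ge) auto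
  moreover have "conformal_factor n p > 0" using assms by (intro conformal_factor_pos) auto
  ultimately show "link_k n p > 0" by (simp add: link_k_def)
  show "(link_k n p)\<^sup>2 = 4 * (conformal_factor n p)\<^sup>2 / level_poly n p"
    using E by (simp add: link_k_def power_divide power_mult_distrib)
qed

text \<open>The requirements on the map in algebraic form. \<open>p = k^2 S T\<close> is the squared
  modulus of the first component; \<open>r^2 S^n = (D - k^2 T) / (n+1)\<close> makes the coefficient
  \<open>p + (n+1) r^2 S^(n+1)\<close> equal to \<open>D S\<close>; \<open>2 r r' = k^(n+1)\<close>,
  with \<open>r'\<close> the factor for exchanged arguments, is the equation of the link. The
  positivity claims keep the quotient and the root in \<open>link_r\<close> smooth.\<close>

lemma link_moduli:
  assumes n: "n \<ge> 1" and p: "0 \<le> p" "p < 1" and ST: "0 \<le> S" "0 \<le> T" "S + T = 1"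
    and level: "level_fun n p = 4 * S * T"
  defines "D \<equiv> conformal_factor n p" and "k \<equiv> link_k n p"
  shows "p = k\<^sup>2 * S * T" "D > 0" "k > 0"
    and "((D - k\<^sup>2 * T) / (n + 1) + k ^ (2 * (n + 1)) * T ^ n) / (S ^ n + 4 * (D - k\<^sup>2 * S) / (n + 1)) > 0"
    and "S ^ n + 4 * (D - k\<^sup>2 * S) / (n + 1) > 0"
    and "link_r n p S T > 0" "(link_r n p S T)\<^sup>2 * S ^ n = (D - k\<^sup>2 * T) / (n + 1)"
    and "2 * link_r n p S T * link_r n p T S = k ^ (n + 1)"
proof -
  define E where "E = level_poly n p"
  define N where "N = real n + 1"
  have Npos: "N > 0" by (simp add: N_def)
  have E4: "E \<ge> 4" unfolding E_def using p by (intro level_poly_ge) auto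
  show D: "D > 0" unfolding D_def using n p by (intro conformal_factor_pos) auto
  show k: "k > 0" unfolding k_def by (rule link_k_sq[OF n p])
  have k2: "k\<^sup>2 = 4 * D\<^sup>2 / E" unfolding k_def D_def E_def by (rule link_k_sq[OF n p])
  have kE: "k\<^sup>2 * E = 4 * D\<^sup>2" using E4 by (simp add: k2)
  have pE: "p * E = 4 * S * T * D\<^sup>2"
    using level D by (simp add: level_fun_def E_def D_def field_simps)
  show pk: "p = k\<^sup>2 * S * T" using pE E4 by (simp add: k2 field_simps)
  have ED: "E - 4 * (D - p) = N\<^sup>2 * p ^ n"
    by (simp add: E_def D_def N_def level_poly_def conformal_factor_def algebra_simps)
  \<comment> \<open>This is \<open>4 q1 q2 = p^(n+1)\<close> for
    \<open>q1 = S (D - k^2 T) / (n+1)\<close> and \<open>q2 = T (D - k^2 S) / (n+1)\<close>, with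
    the common factor \<open>S T\<close> removed so that it retains its content on the axes.\<close>
  have cross: "4 * ((D - k\<^sup>2 * T) * (D - k\<^sup>2 * S)) = N\<^sup>2 * k\<^sup>2 * p ^ n"
  proof -
    have "(D - k\<^sup>2 * T) * (D - k\<^sup>2 * S) = D\<^sup>2 - k\<^sup>2 * D * (S + T) + k\<^sup>2 * (k\<^sup>2 * S * T)"
      by (simp add: algebra_simps power2_eq_square)
    also have "\<dots> = D\<^sup>2 - k\<^sup>2 * (D - p)" using ST(3) pk by (simp add: algebra_simps)
    also have "4 * \<dots> = k\<^sup>2 * (E - 4 * (D - p))" using kE by (simp add: algebra_simps)
    finally show ?thesis unfolding ED by (simp add: mult.commute mult.left_commute)
  qed
  \<comment> \<open>A positive sum together with a nonnegative product makes both terms nonnegative;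
    \<open>p < 1\<close> gives the strictness.\<close>
  have sum_pos: "(D - k\<^sup>2 * T) + (D - k\<^sup>2 * S) > 0"
  proof -
    have "E - 2 * D = 2 * N * (1 - p) + N\<^sup>2 * p ^ n"
      by (simp add: E_def D_def N_def level_poly_def conformal_factor_def algebra_simps)
    moreover have "2 * N * (1 - p) > 0" using Npos p by simp
    moreover have "N\<^sup>2 * p ^ n \<ge> 0" using p by simp
    ultimately have "E - 2 * D > 0" by linarith
    then have "2 * D * (E - 2 * D) / E > 0" using D E4 by simp
    also have "2 * D * (E - 2 * D) / E = 2 * D - k\<^sup>2" 
      unfolding k2 using E4 by (simp add: field_simps power2_eq_square)
    also have "\<dots> = 2 * D - k\<^sup>2 * (S + T)" using ST(3) by simp
    also have "\<dots> = (D - k\<^sup>2 * T) + (D - k\<^sup>2 * S)" by (simp add: algebra_simps)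
    finally show ?thesis .
  qed
  have "N\<^sup>2 * k\<^sup>2 * p ^ n \<ge> 0" using p by simp
  then have prod: "(D - k\<^sup>2 * T) * (D - k\<^sup>2 * S) \<ge> 0" using cross by linarith
  have nn: "D - k\<^sup>2 * T \<ge> 0" "D - k\<^sup>2 * S \<ge> 0"
    using sum_pos prod by (auto simp: zero_le_mult_iff)
  define a where "a = (D - k\<^sup>2 * T) / N"
  define a' where "a' = k ^ (2 * (n + 1)) * T ^ n"
  define b where "b = S ^ n"
  define b' where "b' = 4 * (D - k\<^sup>2 * S) / N"
  define c where "c = k ^ (2 * (n + 1))"
  have c: "c > 0" using k by (simp add: c_def)
  have nonneg: "a \<ge> 0" "a' \<ge> 0" "b \<ge> 0" "b' \<ge> 0"
    using nn Npos k ST by (auto simp: a_def a'_def b_def b'_def)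
  have aa: "a + a' > 0"
  proof (cases "T = 0")
    case True
    then have "a > 0" using D Npos by (simp add: a_def)
    with nonneg show ?thesis by linarith
  next
    case False
    then have "a' > 0" using ST k by (simp add: a'_def)
    with nonneg show ?thesis by linarith
  qed
  have bb: "b + b' > 0"
  proof (cases "S = 0")
    case True
    then have "b' > 0" using D Npos by (simp add: b'_def)
    with nonneg show ?thesis by linarith
  next
    case False
    then have "b > 0" using ST by (simp add: b_def)
    with nonneg show ?thesis by linarith
  qed
  \<comment> \<open>The fractions \<open>a / b\<close> and \<open>a' / b'\<close> agree in
    cross-multiplied form, so the mediant \<open>(a + a') / (b + b')\<close> equals each of them
    whose denominator is nonzero.\<close>
  have ab: "a * b' = a' * b"
  proof -
    have "a * b' = 4 * ((D - k\<^sup>2 * T) * (D - k\<^sup>2 * S)) / N\<^sup>2"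
      by (simp add: a_def b'_def power2_eq_square)
    also have "\<dots> = k\<^sup>2 * p ^ n" unfolding cross using Npos by simp
    also have "\<dots> = k ^ (2 * (n + 1)) * T ^ n * S ^ n"
      by (simp add: pk power_mult_distrib power_mult power2_eq_square)
    finally show ?thesis by (simp add: a'_def b_def)
  qed
  have r1: "link_r n p S T = sqrt ((a + a') / (b + b'))"
    by (simp add: link_r_def a_def a'_def b_def b'_def N_def D_def k_def add.commute)
  \<comment> \<open>Exchanging \<open>S\<close> and \<open>T\<close> expresses the second quotient
    through the same four terms, essentially inverted, which is why the product of the two quotients
    collapses to \<open>c / 4\<close>.\<close>
  have 2: "(D - k\<^sup>2 * S) / (n + 1) = b' / 4" "4 * (D - k\<^sup>2 * T) / (n + 1) = 4 * a"
    "T ^ n = a' / c" "k ^ (2 * (n + 1)) = c"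
    using k by (simp_all add: a_def b'_def a'_def c_def N_def field_simps)
  have r2: "link_r n p T S = sqrt ((b' / 4 + c * b) / (a' / c + 4 * a))"
    unfolding link_r_def D_def[symmetric] k_def[symmetric] 2 b_def ..
  have 1: "(D - k\<^sup>2 * T) / (n + 1) = a" "4 * (D - k\<^sup>2 * S) / (n + 1) = b'"
    by (simp_all add: a_def b'_def N_def add.commute)
  show "S ^ n + 4 * (D - k\<^sup>2 * S) / (n + 1) > 0" using bb unfolding 1 b_def .
  show "((D - k\<^sup>2 * T) / (n + 1) + k ^ (2 * (n + 1)) * T ^ n) / (S ^ n + 4 * (D - k\<^sup>2 * S) / (n + 1)) > 0"
    using aa bb unfolding 1 b_def a'_def by simp
  show "link_r n p S T > 0" using aa bb by (simp add: r1)
  have "(a + a') * b = a * (b + b')" using ab by (simp add: algebra_simps)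
  then have "(a + a') / (b + b') * b = a" using bb by (simp add: field_simps)
  then show "(link_r n p S T)\<^sup>2 * S ^ n = (D - k\<^sup>2 * T) / (n + 1)"
    unfolding 1 r1 using aa bb by (simp flip: b_def)
  have den: "a' / c + 4 * a > 0"
  proof -
    have "a' / c + 4 * a \<ge> 0" using nonneg c by simp
    moreover have "a' / c + 4 * a \<noteq> 0"
      using nonneg c aa by (smt (verit) divide_nonneg_pos divide_pos_pos)
    ultimately show ?thesis by linarith
  qed
  have "4 * ((a + a') / (b + b') * ((b' / 4 + c * b) / (a' / c + 4 * a))) = c"
  proof -
    have den': "a' + 4 * c * a > 0"
      using den c by (simp add: field_simps)
    have "4 * ((a + a') / (b + b') * ((b' / 4 + c * b) / (a' / c + 4 * a))) =
        c * ((a + a') * (b' + 4 * c * b)) / ((b + b') * (a' + 4 * c * a))"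
      using c bb den den' by (simp add: divide_simps) (simp add: algebra_simps)
    also have "(a + a') * (b' + 4 * c * b) = (b + b') * (a' + 4 * c * a)"
      using ab by (simp add: algebra_simps)
    finally show ?thesis using bb den' by simp
  qed
  moreover have "(a + a') / (b + b') \<ge> 0" "(b' / 4 + c * b) / (a' / c + 4 * a) \<ge> 0"
    using aa bb den nonneg c by simp_all
  moreover have "(2 * sqrt x * sqrt y)\<^sup>2 = 4 * (x * y)" if "x \<ge> 0" "y \<ge> 0" for x y
    using that by (simp add: power_mult_distrib)
  ultimately have "(2 * link_r n p S T * link_r n p T S)\<^sup>2 = c"
    unfolding r1 r2 by metis
  also have "c = (k ^ (n + 1))\<^sup>2" 
    unfolding c_def by (subst mult.commute) (rule power_mult)
  finally have sq: "(2 * link_r n p S T * link_r n p T S)\<^sup>2 = (k ^ (n + 1))\<^sup>2" .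
  have "link_r n p S T \<ge> 0" "link_r n p T S \<ge> 0"
    unfolding r1 r2 using aa bb den nonneg c by simp_all
  then show "2 * link_r n p S T * link_r n p T S = k ^ (n + 1)"
    using k by (intro power2_eq_imp_eq[OF sq]) simp_all
qed

section \<open>The map from the three-sphere onto the link\<close>

definition lens_p :: "nat \<Rightarrow> complex^2 \<Rightarrow> real" where
  "lens_p n x = level_inv n (4 * (norm (x $ 1))\<^sup>2 * (norm (x $ 2))\<^sup>2)"

definition lens_r :: "nat \<Rightarrow> complex^2 \<Rightarrow> real" where
  "lens_r n x = link_r n (lens_p n x) ((norm (x $ 1))\<^sup>2) ((norm (x $ 2))\<^sup>2)"

text \<open>Exchanging \<open>u\<close> and \<open>v\<close> corresponds to exchanging the last two
  components on the link. For surjectivity and local inverses this symmetry leaves only the case of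
  a nonzero first coordinate on the sphere, or second component on the link.\<close>

definition swap2 :: "complex^2 \<Rightarrow> complex^2" where
  "swap2 x = vector [x $ 2, x $ 1]"

definition swap3 :: "complex^3 \<Rightarrow> complex^3" where
  "swap3 z = vector [z $ 1, z $ 3, z $ 2]"

text \<open>The two factors \<open>\<i>\<close> multiply to -1, which turns
  \<open>2 r r' = k^(n+1)\<close> into the equation of the link.\<close>

definition link_map :: "nat \<Rightarrow> complex^2 \<Rightarrow> complex^3" where
  "link_map n x = vector
    [of_real (link_k n (lens_p n x)) * (x $ 1 * x $ 2),
     \<i> * of_real (lens_r n x) * x $ 1 ^ (n + 1),
     \<i> * of_real (lens_r n (swap2 x)) * x $ 2 ^ (n + 1)]"

definition link_set :: "nat \<Rightarrow> (complex^3) set" where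
  "link_set n = {z. (z $ 1) ^ (n + 1) + 2 * z $ 2 * z $ 3 = 0} \<inter> sphere 0 1"

lemma swap_simps [simp]:
  "swap2 x $ 1 = x $ 2" "swap2 x $ 2 = x $ 1"
  "swap3 z $ 1 = z $ 1" "swap3 z $ 2 = z $ 3" "swap3 z $ 3 = z $ 2"
  by (simp_all add: swap2_def swap3_def)

lemma swap_swap [simp]: "swap2 (swap2 x) = x" "swap3 (swap3 z) = z"
  by (simp_all add: vec_eq_iff forall_2 forall_3)

lemma link_map_nth:
  "link_map n x $ 1 = of_real (link_k n (lens_p n x)) * (x $ 1 * x $ 2)"
  "link_map n x $ 2 = \<i> * of_real (lens_r n x) * x $ 1 ^ (n + 1)"
  "link_map n x $ 3 = \<i> * of_real (lens_r n (swap2 x)) * x $ 2 ^ (n + 1)"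
  by (simp_all add: link_map_def)

lemma in_sphere_iff:
  fixes x :: "complex^2" and z :: "complex^3"
  shows "x \<in> sphere 0 1 \<longleftrightarrow> (norm (x $ 1))\<^sup>2 + (norm (x $ 2))\<^sup>2 = 1"
    and "z \<in> sphere 0 1 \<longleftrightarrow> (norm (z $ 1))\<^sup>2 + (norm (z $ 2))\<^sup>2 + (norm (z $ 3))\<^sup>2 = 1"
  by (simp_all add: norm_eq_1 inner_vec_def sum_2 sum_3 power2_norm_eq_inner)

lemma norm_swap2 [simp]: "norm (swap2 x) = norm x"
  by (simp add: norm_eq inner_vec_def sum_2 add.commute)

lemma swap_in_link_set [simp]: "swap3 z \<in> link_set n \<longleftrightarrow> z \<in> link_set n"
  unfolding link_set_def Int_iff in_sphere_iff by (simp add: ac_simps)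

lemma lens_p_swap [simp]: "lens_p n (swap2 x) = lens_p n x"
  by (simp add: lens_p_def mult.commute mult.left_commute)

lemma link_map_swap: "link_map n (swap2 x) = swap3 (link_map n x)"
  by (simp add: vec_eq_iff forall_3 link_map_nth mult.commute)

text \<open>On the sphere \<open>4 S T = 1 - (2 S - 1)^2\<close>, which keeps the argument of
  \<open>level_inv\<close> in [0, 1].\<close>

lemma lens_p:
  assumes n: "n \<ge> 1" and x: "x \<in> sphere 0 1"
  shows "0 \<le> lens_p n x" "lens_p n x < 1"
    "level_fun n (lens_p n x) = 4 * (norm (x $ 1))\<^sup>2 * (norm (x $ 2))\<^sup>2"
    "smooth_at (level_inv n) (4 * (norm (x $ 1))\<^sup>2 * (norm (x $ 2))\<^sup>2)"
proof -
  define S where "S = (norm (x $ 1))\<^sup>2"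
  define T where "T = (norm (x $ 2))\<^sup>2"
  have T: "T = 1 - S" using x unfolding in_sphere_iff S_def T_def by simp
  have "4 * S * T = 1 - (2 * S - 1)\<^sup>2" by (simp add: T power2_eq_square algebra_simps)
  then have "4 * S * T \<le> 1" by simp
  moreover have "0 \<le> 4 * S * T" by (simp add: S_def T_def)
  ultimately show "0 \<le> lens_p n x" "lens_p n x < 1"
    "level_fun n (lens_p n x) = 4 * (norm (x $ 1))\<^sup>2 * (norm (x $ 2))\<^sup>2"
    "smooth_at (level_inv n) (4 * (norm (x $ 1))\<^sup>2 * (norm (x $ 2))\<^sup>2)"
    unfolding lens_p_def S_def[symmetric] T_def[symmetric] using level_inv[OF n] by auto
qed

lemmas lens_moduli = link_moduli[OF _ lens_p(1,2) zero_le_power2 zero_le_power2 in_sphere_iff(1)[THEN iffD1] lens_p(3),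
    folded lens_r_def]

lemma lens_r_swap_eq: "lens_r n (swap2 x) = link_r n (lens_p n x) ((norm (x $ 2))\<^sup>2) ((norm (x $ 1))\<^sup>2)"
  by (simp add: lens_r_def)

text \<open>The second identity is \<open>D S = p + (n+1) q1\<close> solved for \<open>q1\<close>;
  read backwards, it recovers the moduli of \<open>x\<close> from those of its image.\<close>

lemma norm_link_map:
  assumes n: "n \<ge> 1" and x: "x \<in> sphere 0 1"
  shows "(norm (link_map n x $ 1))\<^sup>2 = lens_p n x"
    and "(norm (link_map n x $ 2))\<^sup>2 =
      ((norm (x $ 1))\<^sup>2 * conformal_factor n (lens_p n x) - lens_p n x) / (n + 1)"
proof -
  let ?p = "lens_p n x" and ?S = "(norm (x $ 1))\<^sup>2" and ?T = "(norm (x $ 2))\<^sup>2"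
  note m = lens_moduli[OF n n x n x x n x]
  show "(norm (link_map n x $ 1))\<^sup>2 = ?p"
    using m(1) by (simp add: link_map_nth norm_mult power_mult_distrib)
  have "(norm (link_map n x $ 2))\<^sup>2 = (lens_r n x)\<^sup>2 * ?S ^ n * ?S"
    by (simp add: link_map_nth norm_mult norm_power power_mult_distrib power2_eq_square)
  also have "\<dots> = (conformal_factor n ?p - (link_k n ?p)\<^sup>2 * ?T) / (n + 1) * ?S"
    using m(7) by simp
  also have "\<dots> = (?S * conformal_factor n ?p - (link_k n ?p)\<^sup>2 * ?S * ?T) / (n + 1)"
    by (simp add: algebra_simps)
  also have "\<dots> = (?S * conformal_factor n ?p - ?p) / (n + 1)"
    using m(1) by simp
  finally show "(norm (link_map n x $ 2))\<^sup>2 = (?S * conformal_factor n ?p - ?p) / (n + 1)" .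
qed

lemma link_map_in_link_set:
  assumes n: "n \<ge> 1" and x: "x \<in> sphere 0 1"
  shows "link_map n x \<in> link_set n"
proof -
  let ?p = "lens_p n x" and ?S = "(norm (x $ 1))\<^sup>2" and ?T = "(norm (x $ 2))\<^sup>2"
  let ?D = "conformal_factor n ?p"
  note m = lens_moduli[OF n n x n x x n x]
  have r: "2 * lens_r n x * lens_r n (swap2 x) = link_k n ?p ^ (n + 1)"
    using m(8) by (simp add: lens_r_swap_eq)
  have "(link_map n x $ 1) ^ (n + 1) + 2 * link_map n x $ 2 * link_map n x $ 3 =
      of_real (link_k n ?p ^ (n + 1) - 2 * lens_r n x * lens_r n (swap2 x)) * (x $ 1 ^ (n + 1) * x $ 2 ^ (n + 1))"
    by (simp add: link_map_nth power_mult_distrib algebra_simps)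
  then have "(link_map n x $ 1) ^ (n + 1) + 2 * link_map n x $ 2 * link_map n x $ 3 = 0"
    using r by simp
  moreover have "link_map n x \<in> sphere 0 1"
  proof -
    have 3: "(norm (link_map n x $ 3))\<^sup>2 = (?T * ?D - ?p) / (n + 1)"
      using norm_link_map(2)[OF n, of "swap2 x"] x by (simp add: link_map_swap)
    have "?p + (?S * ?D - ?p) / (n + 1) + (?T * ?D - ?p) / (n + 1) = ?p + ((?S + ?T) * ?D - 2 * ?p) / (n + 1)"
      by (simp add: add_divide_distrib diff_divide_distrib algebra_simps)
    also have "?S + ?T = 1" using x unfolding in_sphere_iff .
    also have "?p + (1 * ?D - 2 * ?p) / (n + 1) = 1"
      by (simp add: conformal_factor_def field_simps)
    finally show ?thesis unfolding in_sphere_iff norm_link_map[OF n x] 3 .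
  qed
  ultimately show ?thesis by (simp add: link_set_def)
qed


text \<open>The preimage of \<open>z\<close> whose first coordinate has the argument of \<open>\<omega>\<close>.\<close>

definition link_section :: "nat \<Rightarrow> complex \<Rightarrow> complex^3 \<Rightarrow> complex^2" where
  "link_section n \<omega> z =
    (let p = (norm (z $ 1))\<^sup>2;
         u = \<omega> * of_real (sqrt ((p + (real n + 1) * (norm (z $ 2))\<^sup>2) / conformal_factor n p))
     in vector [u, z $ 1 / (of_real (link_k n p) * u)])"

text \<open>The moduli invert the identities for the norms, and the direction of the second
  component is right because \<open>\<omega>\<close> is an (n+1)-th root of the direction of
  \<open>z $ 2 / \<i>\<close>. The third component follows from the equation of the link, which
  determines it when \<open>z $ 2\<close> is nonzero.\<close>

lemma link_section:
  assumes n: "n \<ge> 1" and z: "z \<in> link_set n" and z2: "z $ 2 \<noteq> 0"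
    and \<omega>: "norm \<omega> = 1" "z $ 2 = \<i> * of_real (norm (z $ 2)) * \<omega> ^ (n + 1)"
  shows "link_section n \<omega> z \<in> sphere 0 1" "link_map n (link_section n \<omega> z) = z"
proof -
  define p where "p = (norm (z $ 1))\<^sup>2"
  define a where "a = (norm (z $ 2))\<^sup>2"
  define b where "b = (norm (z $ 3))\<^sup>2"
  define D where "D = conformal_factor n p"
  define E where "E = level_poly n p"
  define k where "k = link_k n p"
  define N where "N = real n + 1"
  define S where "S = (p + N * a) / D"
  define u where "u = \<omega> * of_real (sqrt S)"
  define v where "v = z $ 1 / (of_real k * u)"
  define x where "x = link_section n \<omega> z"
  have x_nth: "x $ 1 = u" "x $ 2 = v"
    by (simp_all add: x_def link_section_def Let_def u_def v_def S_def D_def k_def a_def p_def N_def add.commute)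
  have sum1: "p + a + b = 1" using z unfolding link_set_def Int_iff in_sphere_iff p_def a_def b_def by simp
  have eqz: "(z $ 1) ^ (n + 1) = - (2 * z $ 2 * z $ 3)"
    using z by (simp add: link_set_def add_eq_0_iff2)
  have a: "a > 0" using z2 by (simp add: a_def)
  have p: "0 \<le> p" "p < 1" 
  proof -
    show "0 \<le> p" by (simp add: p_def)
    have "b \<ge> 0" by (simp add: b_def)
    with sum1 a show "p < 1" by linarith
  qed
  have "(norm ((z $ 1) ^ (n + 1)))\<^sup>2 = (norm (2 * z $ 2 * z $ 3))\<^sup>2" unfolding eqz by simp
  then have pab: "p ^ (n + 1) = 4 * a * b"
    by (simp add: norm_power norm_mult power_mult_distrib p_def a_def b_def power2_eq_square mult_ac)
  have D: "D > 0" unfolding D_def using n p by (intro conformal_factor_pos) auto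
  have E: "E \<ge> 4" unfolding E_def using p by (intro level_poly_ge) auto
  have k: "k > 0" and kE: "k\<^sup>2 * E = 4 * D\<^sup>2"
    using link_k_sq[OF n p] E unfolding k_def D_def E_def by simp_all
  have N: "N > 0" by (simp add: N_def)
  have S: "S > 0" unfolding S_def using p a D N by (intro divide_pos_pos add_nonneg_pos) auto
  have norm_u: "(norm u)\<^sup>2 = S" using \<omega> S by (simp add: u_def norm_mult power_mult_distrib)
  have u0: "u \<noteq> 0" using norm_u S by auto
  have pE: "p * E = 4 * (p + N * a) * (p + N * b)"
  proof -
    have "4 * (p + N * a) * (p + N * b) = 4 * p\<^sup>2 + 4 * p * N * (a + b) + N\<^sup>2 * (4 * a * b)"
      by (simp add: algebra_simps power2_eq_square)
    also have "a + b = 1 - p" using sum1 by simp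
    also have "4 * p\<^sup>2 + 4 * p * N * (1 - p) + N\<^sup>2 * (4 * a * b) = p * E"
      unfolding pab[symmetric] by (simp add: E_def level_poly_def N_def algebra_simps power2_eq_square)
    finally show ?thesis by simp
  qed
  have DS: "D * (1 - S) = p + N * b"
  proof -
    have "D * (1 - S) = D - (p + N * a)" using D by (simp add: S_def field_simps)
    also have "\<dots> = N * (1 - p - a) + p" by (simp add: D_def N_def conformal_factor_def algebra_simps)
    also have "1 - p - a = b" using sum1 by simp
    finally show ?thesis by simp
  qed
  have pE': "p * E = 4 * S * (1 - S) * D\<^sup>2"
  proof -
    have "4 * S * (1 - S) * D\<^sup>2 = 4 * (D * S) * (D * (1 - S))" by (simp add: power2_eq_square)
    also have "D * S = p + N * a" using D by (simp add: S_def)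
    finally show ?thesis unfolding DS pE by simp
  qed
  have norm_v: "(norm v)\<^sup>2 = 1 - S"
  proof -
    have "p = k\<^sup>2 * S * (1 - S)"
    proof -
      have "E * p = 4 * D\<^sup>2 * (S * (1 - S))" using pE' by (simp add: mult_ac)
      then have "E * p = E * (k\<^sup>2 * S * (1 - S))" unfolding kE[symmetric] by (simp add: mult_ac)
      then show ?thesis using E by simp
    qed
    moreover have "(norm v)\<^sup>2 = p / (k\<^sup>2 * S)"
      using k norm_u by (simp add: v_def norm_divide norm_mult power_divide power_mult_distrib p_def)
    ultimately show ?thesis using S k by simp
  qed
  show sph: "link_section n \<omega> z \<in> sphere 0 1"
    unfolding x_def[symmetric] in_sphere_iff x_nth norm_u norm_v by simp
  have "4 * S * (1 - S) = level_fun n p"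
    using pE' D by (simp add: level_fun_def E_def D_def field_simps)
  then have xp: "lens_p n x = p"
    unfolding lens_p_def x_nth norm_u norm_v using level_inv_level_fun[OF n p] by simp
  have c1: "link_map n x $ 1 = z $ 1"
    using u0 k by (simp add: link_map_nth xp x_nth v_def flip: k_def)
  have c2: "link_map n x $ 2 = z $ 2"
  proof -
    note m = lens_moduli[OF n n sph n sph sph n sph, folded x_def]
    have "(norm (link_map n x $ 2))\<^sup>2 = (norm (z $ 2))\<^sup>2"
      using norm_link_map(2)[OF n sph] D N
      by (simp add: x_nth norm_u xp S_def a_def N_def add.commute flip: x_def D_def)
    then have "norm (link_map n x $ 2) = norm (z $ 2)" by simp
    moreover have "norm (link_map n x $ 2) = lens_r n x * sqrt S ^ (n + 1)"
      using m(6) \<omega> S by (simp add: link_map_nth norm_mult norm_power x_nth u_def)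
    ultimately have r: "lens_r n x * sqrt S ^ (n + 1) = norm (z $ 2)" by simp
    have "link_map n x $ 2 = \<i> * of_real (lens_r n x * sqrt S ^ (n + 1)) * \<omega> ^ (n + 1)"
      by (simp add: link_map_nth x_nth u_def power_mult_distrib)
    then show ?thesis unfolding r using \<omega>(2) by simp
  qed
  have c3: "link_map n x $ 3 = z $ 3"
  proof -
    have "(link_map n x $ 1) ^ (n + 1) + 2 * link_map n x $ 2 * link_map n x $ 3 = 0"
      using link_map_in_link_set[OF n sph] by (simp add: link_set_def x_def)
    then have "2 * z $ 2 * link_map n x $ 3 = 2 * z $ 2 * z $ 3"
      unfolding c1 c2 eqz by (simp add: algebra_simps)
    then show ?thesis using z2 by simp
  qed
  show "link_map n (link_section n \<omega> z) = z"
    using c1 c2 c3 by (simp add: vec_eq_iff forall_3 x_def)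
qed

text \<open>The other composite. The norms of the image give back \<open>S\<close>, and the
  remaining ambiguity, the argument of the first coordinate, is resolved by
  \<open>\<omega> = sgn (x $ 1)\<close>; the last two claims show that this choice is admissible in
  \<open>link_section\<close>.\<close>

lemma link_section_link_map:
  assumes n: "n \<ge> 1" and x: "x \<in> sphere 0 1" and x1: "x $ 1 \<noteq> 0"
  shows "link_section n (sgn (x $ 1)) (link_map n x) = x"
    and "link_map n x $ 2 = \<i> * of_real (norm (link_map n x $ 2)) * sgn (x $ 1) ^ (n + 1)"
    and "link_map n x $ 2 \<noteq> 0"
proof -
  note m = lens_moduli[OF n n x n x x n x]
  have N: "real n + 1 > 0" by simp
  have S: "(lens_p n x + (real n + 1) * (norm (link_map n x $ 2))\<^sup>2) / conformal_factor n (lens_p n x) = (norm (x $ 1))\<^sup>2"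
    unfolding norm_link_map[OF n x] using m(2) by (simp add: add.commute)
  have sgn: "sgn (x $ 1) * of_real (norm (x $ 1)) = x $ 1"
    using x1 by (simp add: sgn_eq)
  show "link_section n (sgn (x $ 1)) (link_map n x) = x"
    unfolding link_section_def Let_def
    unfolding norm_link_map(1)[OF n x] S real_sqrt_abs abs_norm_cancel
    using sgn x1 m(3) by (simp add: vec_eq_iff forall_2 link_map_nth)
  have nr: "norm (link_map n x $ 2) = lens_r n x * norm (x $ 1) ^ (n + 1)"
    using m(6) by (simp add: link_map_nth norm_mult norm_power)
  have pow: "sgn (x $ 1) ^ (n + 1) * of_real (norm (x $ 1)) ^ (n + 1) = x $ 1 ^ (n + 1)"
    unfolding power_mult_distrib[symmetric] sgn ..
  show "link_map n x $ 2 = \<i> * of_real (norm (link_map n x $ 2)) * sgn (x $ 1) ^ (n + 1)"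
    unfolding nr unfolding link_map_nth(2) pow[symmetric] of_real_mult of_real_power by (simp only: mult_ac)
  show "link_map n x $ 2 \<noteq> 0" using m(6) x1 by (simp add: link_map_nth)
qed

section \<open>Smoothness of the map and the pullback of the form\<close>

lemma smooth_at_norm_sq_nth:
  "smooth_at (\<lambda>x :: complex^'n. (norm (x $ i))\<^sup>2) y"
  unfolding power2_norm_eq_inner
  by (intro smooth_at_inner smooth_at_linear[OF bounded_linear_vec_nth] smooth_at_id)

lemma smooth_at_conformal_factor:
  "smooth_at g x \<Longrightarrow> smooth_at (\<lambda>x. conformal_factor n (g x)) x"
  unfolding conformal_factor_def by (intro smooth_at_diff smooth_at_mult smooth_at_const)

lemma smooth_at_link_k:
  assumes "smooth_at g x" "0 \<le> g x" "g x < 1"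
  shows "smooth_at (\<lambda>x. link_k n (g x)) x"
proof -
  have "level_poly n (g x) > 0" using level_poly_ge[of "g x" n] assms by simp
  then have "sqrt (level_poly n (g x)) \<noteq> 0" by simp
  moreover have "smooth_at (\<lambda>x. level_poly n (g x)) x"
    unfolding level_poly_def by (intro smooth_at_diff smooth_at_add smooth_at_mult smooth_at_power smooth_at_const assms(1))
  ultimately show ?thesis
    unfolding link_k_def using \<open>level_poly n (g x) > 0\<close>
    by (intro smooth_at_divide_real smooth_at_mult smooth_at_const smooth_at_conformal_factor smooth_at_sqrt assms(1))
qed

lemma smooth_at_lens:
  assumes n: "n \<ge> 1" and x: "x \<in> sphere 0 1"
  shows "smooth_at (lens_p n) x" "smooth_at (\<lambda>x. link_k n (lens_p n x)) x" "smooth_at (lens_r n) x"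
proof -
  show p: "smooth_at (lens_p n) x"
    unfolding lens_p_def[abs_def]
    by (rule smooth_at_compose[where g = "level_inv n" and f = "\<lambda>x. 4 * (norm (x $ 1))\<^sup>2 * (norm (x $ 2))\<^sup>2",
          OF _ lens_p(4)[OF n x]])
       (intro smooth_at_mult smooth_at_const smooth_at_norm_sq_nth)
  show k: "smooth_at (\<lambda>x. link_k n (lens_p n x)) x"
    by (rule smooth_at_link_k[OF p lens_p(1,2)[OF n x]])
  note m = link_moduli[OF n lens_p(1,2)[OF n x] zero_le_power2 zero_le_power2 in_sphere_iff(1)[THEN iffD1, OF x] lens_p(3)[OF n x]]
  have N: "real (n + 1) \<noteq> 0" by simp
  show "smooth_at (lens_r n) x"
    unfolding lens_r_def[abs_def] link_r_def
    by (rule smooth_at_sqrt, rule m(4), rule smooth_at_divide_real, rule less_imp_neq[OF m(5), symmetric])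
       (intro smooth_at_add smooth_at_diff smooth_at_mult smooth_at_power smooth_at_const smooth_at_divide_real[where g = "\<lambda>_. real (n + 1)", OF N]
         smooth_at_conformal_factor p k smooth_at_norm_sq_nth)+
qed

lemma smooth_at_swap: "smooth_at swap2 x" "smooth_at swap3 z"
proof -
  show "smooth_at swap2 x"
  proof (rule smooth_at_vec)
    have "smooth_at (\<lambda>x. swap2 x $ 1) x" "smooth_at (\<lambda>x. swap2 x $ 2) x"
      unfolding swap_simps by (intro smooth_at_linear[OF bounded_linear_vec_nth] smooth_at_id)+
    then show "smooth_at (\<lambda>x. swap2 x $ i) x" for i using exhaust_2[of i] by auto
  qed
  show "smooth_at swap3 z"
  proof (rule smooth_at_vec)
    have "smooth_at (\<lambda>x. swap3 x $ 1) z" "smooth_at (\<lambda>x. swap3 x $ 2) z" "smooth_at (\<lambda>x. swap3 x $ 3) z"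
      unfolding swap_simps by (intro smooth_at_linear[OF bounded_linear_vec_nth] smooth_at_id)+
    then show "smooth_at (\<lambda>x. swap3 x $ i) z" for i using exhaust_3[of i] by auto
  qed
qed

lemma smooth_at_link_map:
  assumes n: "n \<ge> 1" and x: "x \<in> sphere 0 1"
  shows "smooth_at (link_map n) x"
proof (rule smooth_at_vec)
  have x': "swap2 x \<in> sphere 0 1" using x by simp
  have r': "smooth_at (\<lambda>x. lens_r n (swap2 x)) x"
    by (rule smooth_at_compose[OF smooth_at_swap(1) smooth_at_lens(3)[OF n x']])
  note nth = smooth_at_linear[OF bounded_linear_vec_nth smooth_at_id]
  have "smooth_at (\<lambda>x. link_map n x $ 1) x" "smooth_at (\<lambda>x. link_map n x $ 2) x" "smooth_at (\<lambda>x. link_map n x $ 3) x"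
    unfolding link_map_nth
    by (intro smooth_at_mult smooth_at_of_real smooth_at_power smooth_at_const nth smooth_at_lens[OF n x] r')+
  then show "smooth_at (\<lambda>x. link_map n x $ i) x" for i using exhaust_3[of i] by auto
qed

text \<open>The derivative \<open>r'\<close> of the radial factor enters with the real number
  \<open>r r' |a|^(2(n+1))\<close> and drops out of the imaginary part; the angular term is
  multiplied by the winding number \<open>n + 1\<close>.\<close>

lemma Im_cnj_power_deriv:
  "Im (cnj (\<i> * of_real r * a ^ (n + 1)) * (\<i> * of_real r' * a ^ (n + 1) + \<i> * of_real r * (of_nat (n + 1) * a ^ n * w)))
    = real (n + 1) * (r\<^sup>2 * ((norm a)\<^sup>2) ^ n) * Im (cnj a * w)"
proof -
  have m: "cnj (a ^ m) * a ^ m = of_real (((norm a)\<^sup>2) ^ m)" for m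
  proof -
    have "cnj (a ^ m) * a ^ m = (a * cnj a) ^ m" by (simp add: power_mult_distrib mult.commute)
    then show ?thesis by (simp only: complex_norm_square[symmetric] of_real_power)
  qed
  have "cnj (\<i> * of_real r * a ^ (n + 1)) * (\<i> * of_real r' * a ^ (n + 1) + \<i> * of_real r * (of_nat (n + 1) * a ^ n * w)) =
    of_real (r * r') * (cnj (a ^ (n + 1)) * a ^ (n + 1)) + of_real (r\<^sup>2 * (n + 1)) * (cnj (a ^ n) * a ^ n) * (cnj a * w)"
    by (simp add: algebra_simps power2_eq_square)
  also have "\<dots> = of_real (r * r' * ((norm a)\<^sup>2) ^ (n + 1)) + of_real (r\<^sup>2 * (n + 1) * ((norm a)\<^sup>2) ^ n) * (cnj a * w)"
    unfolding m by simp
  finally have eq: "cnj (\<i> * of_real r * a ^ (n + 1)) *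
      (\<i> * of_real r' * a ^ (n + 1) + \<i> * of_real r * (of_nat (n + 1) * a ^ n * w)) = \<dots>" .
  have Im: "Im (of_real A + of_real B * Z) = B * Im Z" for A B Z by simp
  show ?thesis unfolding eq Im by (simp only: mult_ac)
qed

text \<open>The term with \<open>k'\<close> is again real. The arguments of \<open>a\<close> and
  \<open>b\<close> add up, so both angular velocities carry the weight \<open>|k a b|^2\<close>,
  written without dividing by \<open>|a|^2\<close> or \<open>|b|^2\<close>.\<close>

lemma Im_cnj_product_deriv:
  "Im (cnj (of_real k * (a * b)) * (of_real k' * (a * b) + of_real k * (v * b + a * w)))
    = k\<^sup>2 * (norm b)\<^sup>2 * Im (cnj a * v) + k\<^sup>2 * (norm a)\<^sup>2 * Im (cnj b * w)"
  unfolding cmod_power2 by (simp add: algebra_simps power2_eq_square)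

text \<open>Radial factors do not contribute to the pairing, so only the angular derivatives remain.\<close>

lemma std_pairing_link_map:
  assumes n: "n \<ge> 1" and x: "x \<in> sphere 0 1"
  shows "std_pairing (link_map n x) (frechet_derivative (link_map n) (at x) w) =
    of_real (conformal_factor n (lens_p n x)) * std_pairing x w"
proof -
  define p where "p = lens_p n x"
  define k where "k = link_k n p"
  define D where "D = conformal_factor n p"
  define S where "S = (norm (x $ 1))\<^sup>2"
  define T where "T = (norm (x $ 2))\<^sup>2"
  define f' where "f' = frechet_derivative (link_map n) (at x)"
  have x': "swap2 x \<in> sphere 0 1" using x by simp
  have "(link_map n has_derivative f') (at x)"
    using smooth_at_imp_differentiable[OF smooth_at_link_map[OF n x]]
    by (simp add: f'_def frechet_derivative_works)
  then have comp: "((\<lambda>x. link_map n x $ i) has_derivative (\<lambda>w. f' w $ i)) (at x)" for i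
    by (rule bounded_linear.has_derivative[OF bounded_linear_vec_nth])
  have nth: "((\<lambda>x :: complex^2. x $ i) has_derivative (\<lambda>w. w $ i)) (at x)" for i
    by (rule bounded_linear_imp_has_derivative[OF bounded_linear_vec_nth])
  obtain k' where k': "((\<lambda>x. link_k n (lens_p n x)) has_derivative k') (at x)"
    using smooth_at_imp_differentiable[OF smooth_at_lens(2)[OF n x]] by (auto simp: differentiable_def)
  obtain r1 where r1: "(lens_r n has_derivative r1) (at x)"
    using smooth_at_imp_differentiable[OF smooth_at_lens(3)[OF n x]] by (auto simp: differentiable_def)
  obtain r2 where r2: "((\<lambda>x. lens_r n (swap2 x)) has_derivative r2) (at x)"
    using smooth_at_imp_differentiable[OF smooth_at_compose[OF smooth_at_swap(1) smooth_at_lens(3)[OF n x']]]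
    by (auto simp: differentiable_def)
  have "((\<lambda>x. link_map n x $ 1) has_derivative
      (\<lambda>w. of_real (k' w) * (x $ 1 * x $ 2) + of_real k * (w $ 1 * x $ 2 + x $ 1 * w $ 2))) (at x)"
    unfolding link_map_nth
    by (rule has_derivative_eq_rhs[OF has_derivative_mult[OF has_derivative_of_real[OF k'] has_derivative_mult[OF nth nth]]])
       (simp add: k_def p_def fun_eq_iff algebra_simps)
  from has_derivative_unique[OF comp this]
  have c1: "f' w $ 1 = of_real (k' w) * (x $ 1 * x $ 2) + of_real k * (w $ 1 * x $ 2 + x $ 1 * w $ 2)"
    by (rule fun_cong)
  have pow: "((\<lambda>x. \<i> * of_real (r x) * x $ i ^ (n + 1)) has_derivative
      (\<lambda>w. \<i> * of_real (r' w) * x $ i ^ (n + 1) + \<i> * of_real (r x) * (of_nat (n + 1) * x $ i ^ n * w $ i))) (at x)"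
    if "(r has_derivative r') (at x)" for r r' i
    by (rule has_derivative_eq_rhs[OF has_derivative_mult[OF
          has_derivative_mult_right[OF has_derivative_of_real[OF that]] has_derivative_power[OF nth]]])
       (simp add: fun_eq_iff algebra_simps)
  have c2: "f' w $ 2 = \<i> * of_real (r1 w) * x $ 1 ^ (n + 1) + \<i> * of_real (lens_r n x) * (of_nat (n + 1) * x $ 1 ^ n * w $ 1)"
    by (rule fun_cong[OF has_derivative_unique[OF comp]]) (unfold link_map_nth, rule pow[OF r1])
  have c3: "f' w $ 3 = \<i> * of_real (r2 w) * x $ 2 ^ (n + 1) + \<i> * of_real (lens_r n (swap2 x)) * (of_nat (n + 1) * x $ 2 ^ n * w $ 2)"
    by (rule fun_cong[OF has_derivative_unique[OF comp]]) (unfold link_map_nth, rule pow[OF r2])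
  have "(lens_r n x)\<^sup>2 * S ^ n = (D - k\<^sup>2 * T) / (n + 1)"
    using lens_moduli(7)[OF n n x n x x n x] unfolding S_def T_def D_def k_def p_def .
  then have 1: "real (n + 1) * ((lens_r n x)\<^sup>2 * S ^ n) = D - k\<^sup>2 * T"
    by (simp add: field_simps)
  have "(lens_r n (swap2 x))\<^sup>2 * T ^ n = (D - k\<^sup>2 * S) / (n + 1)"
    using lens_moduli(7)[OF n n x' n x' x' n x'] unfolding S_def T_def D_def k_def p_def by simp
  then have 2: "real (n + 1) * ((lens_r n (swap2 x))\<^sup>2 * T ^ n) = D - k\<^sup>2 * S"
    by (simp add: field_simps)
  \<comment> \<open>Each variable collects \<open>k^2 T\<close> or \<open>k^2 S\<close> from the
    product and the complement to \<open>D\<close> from its power.\<close>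
  have "(\<Sum>j\<in>UNIV. Im (cnj (link_map n x $ j) * f' w $ j)) =
      (k\<^sup>2 * T * Im (cnj (x $ 1) * w $ 1) + k\<^sup>2 * S * Im (cnj (x $ 2) * w $ 2))
      + (D - k\<^sup>2 * T) * Im (cnj (x $ 1) * w $ 1) + (D - k\<^sup>2 * S) * Im (cnj (x $ 2) * w $ 2)"
    unfolding sum_3 c1 c2 c3 link_map_nth p_def[symmetric] k_def[symmetric] Im_cnj_power_deriv Im_cnj_product_deriv
      S_def[symmetric] T_def[symmetric] 1 2 ..
  also have "\<dots> = D * (\<Sum>j\<in>UNIV. Im (cnj (x $ j) * w $ j))"
    unfolding sum_2 by (simp add: algebra_simps)
  finally show ?thesis
    unfolding std_pairing_def f'_def D_def p_def by simp
qed

section \<open>Surjectivity and smooth local inverses\<close>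

lemma exp_ii_Im_Ln: "q \<noteq> 0 \<Longrightarrow> exp (\<i> * of_real (Im (Ln q))) = sgn q"
proof -
  assume q: "q \<noteq> 0"
  have "q = of_real (norm q) * exp (\<i> * of_real (Im (Ln q)))"
    using exp_eq_polar[of "Ln q"] q by (simp add: cis_conv_exp)
  then show ?thesis using q by (metis eq_divide_imp mult.commute norm_eq_zero of_real_eq_0_iff sgn_eq)
qed

lemma root_of_direction:
  fixes z :: complex
  assumes "z \<noteq> 0" "n \<ge> 1"
  obtains \<omega> where "norm \<omega> = 1" "\<omega> ^ n = sgn z"
proof
  let ?\<omega> = "exp (\<i> * of_real (Im (Ln z)) / of_nat n)"
  show "norm ?\<omega> = 1" by (simp add: norm_exp_eq_Re)
  have "?\<omega> ^ n = exp (of_nat n * (\<i> * of_real (Im (Ln z)) / of_nat n))" by (rule exp_of_nat_mult[symmetric])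
  also have "\<dots> = exp (\<i> * of_real (Im (Ln z)))" using assms by simp
  finally show "?\<omega> ^ n = sgn z" using exp_ii_Im_Ln[OF assms(1)] by simp
qed

text \<open>A section exists where \<open>z $ 2\<close> is nonzero and, by symmetry, where
  \<open>z $ 3\<close> is; if both vanish, the equation forces \<open>z $ 1 = 0\<close>,
  contradicting norm 1.\<close>

lemma link_map_surj:
  assumes n: "n \<ge> 1" and z: "z \<in> link_set n"
  shows "z \<in> link_map n ` sphere 0 1"
proof -
  have main: "\<exists>x\<in>sphere 0 1. link_map n x = z" if z: "z \<in> link_set n" and z2: "z $ 2 \<noteq> 0" for z
  proof -
    obtain \<omega> where \<omega>: "norm \<omega> = 1" "\<omega> ^ (n + 1) = sgn (z $ 2 / \<i>)"
      using root_of_direction[of "z $ 2 / \<i>" "n + 1"] z2 by auto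
    have "z $ 2 = \<i> * of_real (norm (z $ 2)) * \<omega> ^ (n + 1)"
      unfolding \<omega>(2) using z2 by (simp add: sgn_eq norm_mult)
    from link_section[OF n z z2 \<omega>(1) this] show ?thesis by blast
  qed
  consider "z $ 2 \<noteq> 0" | "z $ 3 \<noteq> 0" | "z $ 2 = 0" "z $ 3 = 0" by blast
  then show ?thesis
  proof cases
    case 1
    from main[OF z 1] show ?thesis by blast
  next
    case 2
    then obtain x where x: "x \<in> sphere 0 1" "link_map n x = swap3 z"
      using main[of "swap3 z"] z by auto
    then have "link_map n (swap2 x) = z" by (simp add: link_map_swap)
    moreover have "swap2 x \<in> sphere 0 1" using x by simp
    ultimately show ?thesis by blast
  next
    case 3
    then have "z $ 1 = 0" using z by (auto simp: link_set_def)
    with 3 have "z \<notin> sphere 0 1" unfolding in_sphere_iff by simp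
    then show ?thesis using z by (simp add: link_set_def)
  qed
qed

text \<open>A branch of the (n+1)-th root of the direction of \<open>z $ 2 / \<i>\<close>,
  normalised to \<open>sgn (x $ 1)\<close> at the image of \<open>x\<close>. Dividing by
  \<open>link_map n x $ 2\<close> puts the cut of \<open>Ln\<close> opposite to that image.\<close>

definition local_root :: "nat \<Rightarrow> complex^2 \<Rightarrow> complex^3 \<Rightarrow> complex" where
  "local_root n x z = sgn (x $ 1) * exp (\<i> * of_real (Im (Ln (z $ 2 / link_map n x $ 2)) / (n + 1)))"

lemma smooth_at_local_root:
  assumes "z $ 2 / link_map n x $ 2 \<notin> \<real>\<^sub>\<le>\<^sub>0"
  shows "smooth_at (local_root n x) z"
proof -
  have q: "smooth_at (\<lambda>z. z $ 2 / link_map n x $ 2) z"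
    unfolding divide_inverse
    by (intro smooth_at_mult smooth_at_const smooth_at_linear[OF bounded_linear_vec_nth smooth_at_id])
  have "smooth_at (\<lambda>z. Ln (z $ 2 / link_map n x $ 2)) z"
    by (rule smooth_at_holomorphic[of Ln "- \<real>\<^sub>\<le>\<^sub>0", OF _ _ _ q])
       (use assms in \<open>auto intro: holomorphic_on_Ln\<close>)
  then have "smooth_at (\<lambda>z. Im (Ln (z $ 2 / link_map n x $ 2)) / (n + 1)) z"
    unfolding divide_inverse[of "Im _"]
    by (intro smooth_at_mult smooth_at_const smooth_at_linear[OF bounded_linear_Im])
  then have e: "smooth_at (\<lambda>z. \<i> * of_real (Im (Ln (z $ 2 / link_map n x $ 2)) / (n + 1))) z"
    by (intro smooth_at_mult[OF smooth_at_const] smooth_at_of_real)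
  have "smooth_at (\<lambda>z. exp (\<i> * of_real (Im (Ln (z $ 2 / link_map n x $ 2)) / (n + 1)))) z"
    by (rule smooth_at_holomorphic[of exp UNIV, OF _ _ _ e]) (auto intro: holomorphic_intros)
  then show ?thesis
    unfolding local_root_def[abs_def] by (rule smooth_at_mult[OF smooth_at_const])
qed

lemma local_root:
  assumes n: "n \<ge> 1" and x: "x \<in> sphere 0 1" "x $ 1 \<noteq> 0" and z: "z $ 2 \<noteq> 0"
  shows "norm (local_root n x z) = 1" "z $ 2 = \<i> * of_real (norm (z $ 2)) * local_root n x z ^ (n + 1)"
proof -
  let ?y = "link_map n x $ 2" and ?\<omega> = "local_root n x z"
  note y = link_section_link_map(2,3)[OF n x]
  have q: "z $ 2 / ?y \<noteq> 0" using y z by simp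
  show "norm ?\<omega> = 1" using x by (simp add: local_root_def norm_mult norm_sgn norm_exp_eq_Re)
  have "exp (\<i> * of_real (Im (Ln (z $ 2 / ?y)) / (n + 1))) ^ (n + 1) = sgn (z $ 2 / ?y)"
    unfolding exp_of_nat_mult[symmetric] exp_ii_Im_Ln[OF q, symmetric]
    by (rule arg_cong[of _ _ exp]) (simp add: field_simps del: of_nat_Suc)
  then have "\<i> * of_real (norm (z $ 2)) * ?\<omega> ^ (n + 1) =
      \<i> * of_real (norm (z $ 2)) * (sgn (x $ 1) ^ (n + 1) * sgn (z $ 2 / ?y))"
    by (simp only: local_root_def power_mult_distrib)
  also have "\<dots> = of_real (norm (z $ 2)) / of_real (norm ?y) * (\<i> * of_real (norm ?y) * sgn (x $ 1) ^ (n + 1)) * sgn (z $ 2 / ?y)"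
    using y(2) by (simp add: mult_ac)
  also have "\<dots> = of_real (norm (z $ 2)) / of_real (norm ?y) * ?y * sgn (z $ 2 / ?y)"
    unfolding y(1)[symmetric] ..
  also have "\<dots> = z $ 2" using y(2) z by (simp add: sgn_eq norm_divide field_simps)
  finally show "z $ 2 = \<i> * of_real (norm (z $ 2)) * ?\<omega> ^ (n + 1)" by simp
qed

text \<open>The ratio of the second components is a positive multiple of
  \<open>(y $ 1 / x $ 1)^(n+1)\<close>. An argument of modulus below \<open>pi / (n+1)\<close> stays
  below \<open>pi\<close> when multiplied by \<open>n + 1\<close>, so \<open>Ln\<close> turns the
  power into a multiple and the root returns the direction of \<open>y $ 1\<close>.\<close>

lemma local_root_link_map:
  assumes n: "n \<ge> 1" and x: "x \<in> sphere 0 1" "x $ 1 \<noteq> 0" and y: "y \<in> sphere 0 1"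
    and yx: "y $ 1 / x $ 1 \<notin> \<real>\<^sub>\<le>\<^sub>0" "\<bar>Im (Ln (y $ 1 / x $ 1))\<bar> < pi / real (n + 1)"
  shows "local_root n x (link_map n y) = sgn (y $ 1)" "link_map n y $ 2 / link_map n x $ 2 \<notin> \<real>\<^sub>\<le>\<^sub>0"
proof -
  define L where "L = Ln (y $ 1 / x $ 1)"
  define q where "q = link_map n y $ 2 / link_map n x $ 2"
  define c where "c = lens_r n y / lens_r n x"
  have y1: "y $ 1 \<noteq> 0" using yx(1) by auto
  have c: "c > 0" using lens_moduli(6)[OF n n x(1) n x(1) x(1) n x(1)] lens_moduli(6)[OF n n y n y y n y]
    by (simp add: c_def)
  have "q = of_real c * (y $ 1 / x $ 1) ^ (n + 1)"
    by (simp add: q_def link_map_nth c_def power_divide)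
  also have "(y $ 1 / x $ 1) ^ (n + 1) = exp (of_nat (n + 1) * L)"
    unfolding exp_of_nat_mult L_def using x y1 by simp
  also have "of_real c = exp (of_real (ln c))" using c by (simp add: exp_of_real)
  finally have q: "q = exp (of_real (ln c) + of_nat (n + 1) * L)" by (simp only: exp_add)
  have im: "Im (of_real (ln c) + of_nat (n + 1) * L) = real (n + 1) * Im L" by simp
  have "real (n + 1) * \<bar>Im L\<bar> < pi"
    using yx(2) by (simp add: L_def field_simps)
  then have bound: "\<bar>real (n + 1) * Im L\<bar> < pi"
    by (simp only: abs_mult abs_of_nat)
  then have Ln: "Ln q = of_real (ln c) + of_nat (n + 1) * L"
    unfolding q by (intro Ln_exp) (simp_all only: im abs_less_iff, linarith+)
  have q0: "q \<noteq> 0" by (simp add: q)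
  show "link_map n y $ 2 / link_map n x $ 2 \<notin> \<real>\<^sub>\<le>\<^sub>0"
  proof
    assume "link_map n y $ 2 / link_map n x $ 2 \<in> \<real>\<^sub>\<le>\<^sub>0"
    then have "Re q < 0 \<and> Im q = 0"
      using q0 by (auto simp: complex_nonpos_Reals_iff complex_eq_iff simp flip: q_def)
    then have "Im (Ln q) = pi" using Im_Ln_eq_pi[OF q0] by simp
    then show False using bound unfolding Ln im by simp
  qed
  have "local_root n x (link_map n y) = sgn (x $ 1) * exp (\<i> * of_real (Im L))"
    unfolding local_root_def q_def[symmetric] Ln im by simp
  also have "\<dots> = sgn (y $ 1)"
    unfolding L_def using exp_ii_Im_Ln[of "y $ 1 / x $ 1"] x y1 by (simp add: sgn_eq norm_divide)
  finally show "local_root n x (link_map n y) = sgn (y $ 1)" .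
qed

lemma smooth_at_link_section:
  assumes n: "n \<ge> 1" and z: "z \<in> link_set n" "z $ 2 \<noteq> 0" and f: "smooth_at f z" "f z \<noteq> 0"
  shows "smooth_at (\<lambda>z. link_section n (f z) z) z"
proof -
  define p where "p = (\<lambda>z :: complex^3. (norm (z $ 1))\<^sup>2)"
  define S where "S = (\<lambda>z :: complex^3. (p z + (real n + 1) * (norm (z $ 2))\<^sup>2) / conformal_factor n (p z))"
  define u where "u = (\<lambda>z. f z * of_real (sqrt (S z)))"
  have pz: "0 \<le> p z" "p z < 1"
  proof -
    show "0 \<le> p z" by (simp add: p_def)
    have "p z + (norm (z $ 2))\<^sup>2 + (norm (z $ 3))\<^sup>2 = 1"
      using z(1) unfolding link_set_def Int_iff in_sphere_iff p_def by simp
    moreover have "(norm (z $ 2))\<^sup>2 > 0" "(norm (z $ 3))\<^sup>2 \<ge> 0" using z(2) by simp_all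
    ultimately show "p z < 1" by linarith
  qed
  have p: "smooth_at p z" unfolding p_def by (rule smooth_at_norm_sq_nth)
  have D: "conformal_factor n (p z) > 0" using n pz by (intro conformal_factor_pos) auto
  have Sz: "S z > 0" unfolding S_def using pz z(2) D by (intro divide_pos_pos add_nonneg_pos) auto
  have S: "smooth_at S z"
    unfolding S_def
    by (rule smooth_at_divide_real, rule less_imp_neq[OF D, symmetric])
       (intro smooth_at_add smooth_at_mult smooth_at_const smooth_at_norm_sq_nth smooth_at_conformal_factor p)+
  have u: "smooth_at u z"
    unfolding u_def by (intro smooth_at_mult f(1) smooth_at_of_real smooth_at_sqrt[OF Sz S])
  have "of_real (link_k n (p z)) * u z \<noteq> 0"
    using link_k_sq(1)[OF n pz] Sz f(2) by (simp add: u_def)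
  then have v: "smooth_at (\<lambda>z. z $ 1 / (of_real (link_k n (p z)) * u z)) z"
    by (rule smooth_at_divide)
       (intro smooth_at_linear[OF bounded_linear_vec_nth smooth_at_id] smooth_at_mult smooth_at_of_real
         smooth_at_link_k p pz u)+
  have eq: "link_section n (f z) z = vector [u z, z $ 1 / (of_real (link_k n (p z)) * u z)]" for z
    unfolding link_section_def Let_def u_def S_def p_def ..
  show ?thesis
  proof (rule smooth_at_vec)
    show "smooth_at (\<lambda>z. link_section n (f z) z $ i) z" for i
      using u v exhaust_2[of i] unfolding eq by auto
  qed
qed

definition has_local_inverse :: "nat \<Rightarrow> complex^2 \<Rightarrow> bool" where
  "has_local_inverse n x \<longleftrightarrow>
    (\<exists>V W k. open V \<and> x \<in> V \<and> open W \<and> smooth_on (link_set n \<inter> W) k \<and>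
      k ` (link_set n \<inter> W) \<subseteq> sphere 0 1 \<and> (\<forall>z\<in>link_set n \<inter> W. link_map n (k z) = z) \<and>
      (\<forall>y\<in>sphere 0 1 \<inter> V. link_map n y \<in> W \<and> k (link_map n y) = y))"

text \<open>\<open>V\<close> restricts \<open>y $ 1\<close> to a sector of half-angle
  \<open>pi / (n+1)\<close> around \<open>x $ 1\<close>, which the (n+1)-th power opens to a slit
  plane, the range allowed by \<open>W\<close>. Distinct points of an orbit differ by rotations too
  large to lie in this sector together.\<close>

lemma has_local_inverse_fst_nonzero:
  assumes n: "n \<ge> 1" and x: "x \<in> sphere 0 1" "x $ 1 \<noteq> 0"
  shows "has_local_inverse n x"
proof -
  define W where "W = (\<lambda>z :: complex^3. z $ 2 / link_map n x $ 2) -` (- \<real>\<^sub>\<le>\<^sub>0)"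
  define V0 where "V0 = (\<lambda>y :: complex^2. y $ 1 / x $ 1) -` (- \<real>\<^sub>\<le>\<^sub>0)"
  define V where "V = V0 \<inter> (\<lambda>y. \<bar>Im (Ln (y $ 1 / x $ 1))\<bar>) -` {..<pi / real (n + 1)}"
  define k where "k = (\<lambda>z. link_section n (local_root n x z) z)"
  note y2 = link_section_link_map(3)[OF n x]
  have open_slit: "open (- \<real>\<^sub>\<le>\<^sub>0 :: complex set)" by (simp add: open_Compl)
  have "open W" unfolding W_def
    by (intro continuous_open_vimage open_slit continuous_intros) (use y2 in simp)
  have "open V0" unfolding V0_def
    by (intro continuous_open_vimage open_slit continuous_intros) (use x in simp)
  then have "open V" unfolding V_def
    by (intro continuous_open_preimage continuous_intros) (use x in \<open>auto simp: V0_def\<close>)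
  moreover have "x \<in> V" using x by (simp add: V_def V0_def)
  moreover have root: "z $ 2 \<noteq> 0" "z $ 2 / link_map n x $ 2 \<notin> \<real>\<^sub>\<le>\<^sub>0" "local_root n x z \<noteq> 0"
    if "z \<in> W" for z
  proof -
    show "z $ 2 / link_map n x $ 2 \<notin> \<real>\<^sub>\<le>\<^sub>0" using that by (simp add: W_def)
    then show z: "z $ 2 \<noteq> 0" by auto
    show "local_root n x z \<noteq> 0" using local_root(1)[OF n x z] by auto
  qed
  moreover have "smooth_on (link_set n \<inter> W) k"
    unfolding k_def
    by (intro smooth_onI smooth_at_link_section n smooth_at_local_root) (auto simp: root)
  moreover have "k z \<in> sphere 0 1 \<and> link_map n (k z) = z" if "z \<in> link_set n \<inter> W" for z
    unfolding k_def using link_section[OF n _ _ local_root[OF n x]] root that by blast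
  moreover have "link_map n y \<in> W \<and> k (link_map n y) = y" if "y \<in> sphere 0 1 \<inter> V" for y
  proof -
    have y: "y \<in> sphere 0 1" "y $ 1 / x $ 1 \<notin> \<real>\<^sub>\<le>\<^sub>0" "\<bar>Im (Ln (y $ 1 / x $ 1))\<bar> < pi / real (n + 1)"
      using that by (auto simp: V_def V0_def)
    then have "y $ 1 \<noteq> 0" by auto
    then show ?thesis
      unfolding k_def W_def using local_root_link_map[OF n x y] link_section_link_map(1)[OF n y(1)] by simp
  qed
  ultimately show ?thesis
    unfolding has_local_inverse_def using \<open>open W\<close>
    by (intro exI[of _ V] exI[of _ W] exI[of _ k]) blast
qed

text \<open>Where \<open>x $ 1 = 0\<close> the other coordinate is nonzero, and the inverse at the
  exchanged point is conjugated by \<open>swap2\<close> and \<open>swap3\<close>.\<close>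

lemma has_local_inverse:
  assumes n: "n \<ge> 1" and x: "x \<in> sphere 0 1"
  shows "has_local_inverse n x"
proof (cases "x $ 1 = 0")
  case False
  with n x show ?thesis by (rule has_local_inverse_fst_nonzero)
next
  case True
  then have "x $ 2 \<noteq> 0" using x unfolding in_sphere_iff by auto
  then have "has_local_inverse n (swap2 x)"
    using x by (intro has_local_inverse_fst_nonzero n) simp_all
  then obtain V W k where V: "open V" "swap2 x \<in> V" and W: "open W" and k: "smooth_on (link_set n \<inter> W) k"
    "k ` (link_set n \<inter> W) \<subseteq> sphere 0 1" "\<forall>z\<in>link_set n \<inter> W. link_map n (k z) = z"
    "\<forall>y\<in>sphere 0 1 \<inter> V. link_map n y \<in> W \<and> k (link_map n y) = y"
    unfolding has_local_inverse_def by blast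
  define V' where "V' = swap2 -` V"
  define W' where "W' = swap3 -` W"
  define k' where "k' = (\<lambda>z. swap2 (k (swap3 z)))"
  have cont: "continuous_on UNIV swap2" "continuous_on UNIV swap3"
    by (intro smooth_on_continuous_on smooth_onI smooth_at_swap)+
  have "open V'" "open W'"
    unfolding V'_def W'_def using cont V(1) W by (auto intro: open_vimage)
  moreover have sw: "swap3 z \<in> link_set n \<inter> W" if "z \<in> link_set n \<inter> W'" for z
    using that by (simp add: W'_def)
  moreover have "smooth_on (link_set n \<inter> W') k'"
    unfolding k'_def
    by (rule smooth_on_compose[OF smooth_on_compose[OF _ k(1)], of _ swap3 UNIV swap2])
       (use sw in \<open>auto intro: smooth_onI smooth_at_swap\<close>)
  moreover have "k' z \<in> sphere 0 1 \<and> link_map n (k' z) = z" if "z \<in> link_set n \<inter> W'" for z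
  proof -
    have "k (swap3 z) \<in> sphere 0 1" "link_map n (k (swap3 z)) = swap3 z"
      using sw[OF that] k(2,3) by blast+
    then show ?thesis by (simp add: k'_def link_map_swap)
  qed
  moreover have "link_map n y \<in> W' \<and> k' (link_map n y) = y" if "y \<in> sphere 0 1 \<inter> V'" for y
  proof -
    have "swap2 y \<in> sphere 0 1 \<inter> V" using that by (simp add: V'_def)
    then have "link_map n (swap2 y) \<in> W" "k (link_map n (swap2 y)) = swap2 y" using k(4) by blast+
    then show ?thesis by (simp add: W'_def k'_def link_map_swap)
  qed
  ultimately show ?thesis
    unfolding has_local_inverse_def using V(2)
    by (intro exI[of _ V'] exI[of _ W'] exI[of _ k']) (auto simp: V'_def)
qed

section \<open>The cyclic group and its invariants\<close>

definition unit_root :: "nat \<Rightarrow> complex" where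
  "unit_root n = exp (2 * of_real pi * \<i> / of_nat (n + 1))"

lemma unit_root_power: "unit_root n ^ (n + 1) = 1" "unit_root n \<noteq> 0" "norm (unit_root n) = 1"
proof -
  have "unit_root n ^ (n + 1) = exp (of_nat (n + 1) * (2 * of_real pi * \<i> / of_nat (n + 1)))"
    unfolding unit_root_def by (rule exp_of_nat_mult[symmetric])
  also have "of_nat (n + 1) * (2 * of_real pi * \<i> / of_nat (n + 1)) = 2 * of_real pi * \<i>"
    by (simp del: of_nat_Suc of_nat_add)
  finally show "unit_root n ^ (n + 1) = 1" by simp
qed (simp_all add: unit_root_def norm_exp_eq_Re)

lemma root_of_unity_eq_power:
  assumes "w ^ (n + 1) = 1"
  obtains j where "j \<le> n" "w = unit_root n ^ j"
proof -
  have "w \<in> {z. z ^ (n + 1) = 1}" using assms by simp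
  then obtain j where j: "j < n + 1" "w = exp (2 * of_real pi * \<i> * of_nat j / of_nat (n + 1))"
    unfolding complex_roots_unity[OF le_add2] by blast
  have "w = unit_root n ^ j"
    unfolding j(2) unit_root_def exp_of_nat_mult[symmetric] by (rule arg_cong[of _ _ exp]) simp
  with j(1) show thesis by (intro that[of j]) auto
qed

text \<open>For an (n+1)-th root of unity the n-th power is the inverse, so the weights 1 and n act
  by inverse roots; this is why \<open>u v\<close> is invariant.\<close>

lemma lens_rotation_nth:
  "lens_rotation (n + 1) n x $ 1 = unit_root n * x $ 1"
  "lens_rotation (n + 1) n x $ 2 = inverse (unit_root n) * x $ 2"
proof -
  show "lens_rotation (n + 1) n x $ 1 = unit_root n * x $ 1"
    by (simp add: lens_rotation_def unit_root_def)
  have "exp (2 * of_real pi * of_nat n * \<i> / of_nat (n + 1)) = unit_root n ^ n"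
    unfolding unit_root_def exp_of_nat_mult[symmetric] by (rule arg_cong[of _ _ exp]) simp
  also have "\<dots> = inverse (unit_root n)"
    using unit_root_power[of n] by (simp add: inverse_unique)
  finally show "lens_rotation (n + 1) n x $ 2 = inverse (unit_root n) * x $ 2"
    by (simp add: lens_rotation_def)
qed

lemma lens_rotation_funpow_nth:
  "(lens_rotation (n + 1) n ^^ j) x $ 1 = unit_root n ^ j * x $ 1"
  "(lens_rotation (n + 1) n ^^ j) x $ 2 = inverse (unit_root n) ^ j * x $ 2"
proof (induction j)
  case (Suc j)
  {
    case 1
    show ?case using Suc unfolding funpow.simps o_apply lens_rotation_nth by simp
  next
    case 2
    show ?case using Suc unfolding funpow.simps o_apply lens_rotation_nth by simp
  }
qed simp_all

lemma link_map_cong: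
  assumes "norm (y $ 1) = norm (x $ 1)" "norm (y $ 2) = norm (x $ 2)"
    and "y $ 1 * y $ 2 = x $ 1 * x $ 2" "y $ 1 ^ (n + 1) = x $ 1 ^ (n + 1)" "y $ 2 ^ (n + 1) = x $ 2 ^ (n + 1)"
  shows "link_map n y = link_map n x"
proof -
  have p: "lens_p n y = lens_p n x" using assms(1,2) by (simp add: lens_p_def)
  have "lens_r n y = lens_r n x" "lens_r n (swap2 y) = lens_r n (swap2 x)"
    using assms(1,2) by (simp_all add: lens_r_def p)
  then show ?thesis using assms(3-5) by (simp add: vec_eq_iff forall_3 link_map_nth p)
qed

text \<open>The three monomials and the moduli are invariant under the rotation. Conversely, the
  norms of the image determine the moduli of the point, hence the radial factors; these are
  positive, so the monomials themselves agree. If \<open>u\<close> is nonzero,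
  \<open>u^(n+1)\<close> fixes it up to a power of the root, and \<open>u v\<close> then fixes
  \<open>v\<close>.\<close>

lemma lens_rel_eq_kernel:
  assumes n: "n \<ge> 1"
  shows "lens_rel (n + 1) n =
    {(x, y). x \<in> sphere 0 1 \<and> y \<in> sphere 0 1 \<and> link_map n x = link_map n y}"
proof (intro equalityI subsetI)
  let ?\<zeta> = "unit_root n"
  have inv_pow: "(inverse ?\<zeta> ^ j) ^ (n + 1) = 1" "(?\<zeta> ^ j) ^ (n + 1) = 1" for j
    by (metis inverse_1 power_inverse power_mult mult.commute power_one unit_root_power(1))+
  fix a assume "a \<in> lens_rel (n + 1) n"
  then obtain x j where a: "a = (x, (lens_rotation (n + 1) n ^^ j) x)" and x: "x \<in> sphere 0 1"
    by (auto simp: lens_rel_def sphere3_def submanifold_def)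
  define y where "y = (lens_rotation (n + 1) n ^^ j) x"
  have y1: "y $ 1 = ?\<zeta> ^ j * x $ 1" and y2: "y $ 2 = inverse ?\<zeta> ^ j * x $ 2"
    unfolding y_def lens_rotation_funpow_nth by simp_all
  have nm: "norm (y $ 1) = norm (x $ 1)" "norm (y $ 2) = norm (x $ 2)"
    unfolding y1 y2 by (simp_all add: norm_mult norm_power norm_inverse unit_root_power)
  have "y $ 1 * y $ 2 = (?\<zeta> * inverse ?\<zeta>) ^ j * (x $ 1 * x $ 2)"
    unfolding y1 y2 power_mult_distrib by (simp only: mult_ac)
  then have "y $ 1 * y $ 2 = x $ 1 * x $ 2" using unit_root_power(2)[of n] by simp
  moreover have "y $ 1 ^ (n + 1) = x $ 1 ^ (n + 1)" "y $ 2 ^ (n + 1) = x $ 2 ^ (n + 1)"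
    unfolding y1 y2 power_mult_distrib inv_pow by simp_all
  ultimately have "link_map n y = link_map n x" by (rule link_map_cong[OF nm])
  moreover have "y \<in> sphere 0 1" using x unfolding in_sphere_iff nm .
  ultimately show "a \<in> {(x, y). x \<in> sphere 0 1 \<and> y \<in> sphere 0 1 \<and> link_map n x = link_map n y}"
    using x by (simp add: a y_def)
next
  let ?\<zeta> = "unit_root n"
  fix a assume "a \<in> {(x, y). x \<in> sphere 0 1 \<and> y \<in> sphere 0 1 \<and> link_map n x = link_map n y}"
  then obtain x y where a: "a = (x, y)" and x: "x \<in> sphere 0 1" and y: "y \<in> sphere 0 1"
    and eq: "link_map n x = link_map n y" by auto
  have p: "lens_p n y = lens_p n x" using norm_link_map(1)[OF n x] norm_link_map(1)[OF n y] eq by simp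
  have D: "conformal_factor n (lens_p n x) > 0" by (rule lens_moduli(2)[OF n n x n x x n x])
  have "(norm (y $ 1))\<^sup>2 = (norm (x $ 1))\<^sup>2"
    using norm_link_map(2)[OF n x] norm_link_map(2)[OF n y] D unfolding eq p by (simp add: field_simps)
  moreover from this have "(norm (y $ 2))\<^sup>2 = (norm (x $ 2))\<^sup>2"
    using x y unfolding in_sphere_iff by linarith
  ultimately have nm: "norm (y $ 1) = norm (x $ 1)" "norm (y $ 2) = norm (x $ 2)" by simp_all
  have r: "lens_r n y = lens_r n x" "lens_r n (swap2 y) = lens_r n (swap2 x)"
    using nm by (simp_all add: lens_r_def p)
  have x': "swap2 x \<in> sphere 0 1" using x by simp
  have pos: "link_k n (lens_p n x) > 0" "lens_r n x > 0" "lens_r n (swap2 x) > 0"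
    using lens_moduli(3,6)[OF n n x n x x n x] lens_moduli(6)[OF n n x' n x' x' n x'] by simp_all
  have "link_map n y $ i = link_map n x $ i" for i using eq by simp
  from this[of 1] this[of 2] this[of 3]
  have e: "y $ 1 * y $ 2 = x $ 1 * x $ 2" "y $ 1 ^ (n + 1) = x $ 1 ^ (n + 1)" "y $ 2 ^ (n + 1) = x $ 2 ^ (n + 1)"
    using pos unfolding link_map_nth p r by simp_all
  have "\<exists>j. y $ 1 = ?\<zeta> ^ j * x $ 1 \<and> y $ 2 = inverse ?\<zeta> ^ j * x $ 2"
  proof (cases "x $ 1 = 0")
    case False
    then have "(y $ 1 / x $ 1) ^ (n + 1) = 1" unfolding power_divide e(2) by simp
    then obtain j where j: "y $ 1 / x $ 1 = ?\<zeta> ^ j" by (rule root_of_unity_eq_power)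
    then have y1: "y $ 1 = ?\<zeta> ^ j * x $ 1" using False by (simp add: field_simps)
    then have "?\<zeta> ^ j * y $ 2 = x $ 2" using e(1) False by simp
    then have "y $ 2 = inverse ?\<zeta> ^ j * x $ 2"
      using unit_root_power(2)[of n] by (simp add: power_inverse field_simps)
    with y1 show ?thesis by blast
  next
    case True
    then have "y $ 1 = 0" using nm(1) by simp
    have x2: "x $ 2 \<noteq> 0" using True x unfolding in_sphere_iff by auto
    then have "(y $ 2 / x $ 2) ^ (n + 1) = 1" unfolding power_divide e(3) by simp
    then obtain j where j: "j \<le> n" "y $ 2 / x $ 2 = ?\<zeta> ^ j" by (rule root_of_unity_eq_power)
    \<comment> \<open>With \<open>x $ 1 = 0\<close> the exponent comes from the second coordinate,
      where the rotation acts by the inverse root; hence \<open>n + 1 - j\<close> in place of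
      \<open>j\<close>.\<close>
    have "?\<zeta> ^ j * ?\<zeta> ^ (n + 1 - j) = 1"
      unfolding power_add[symmetric] using j(1) unit_root_power(1)[of n] by simp
    then have "?\<zeta> ^ j = inverse ?\<zeta> ^ (n + 1 - j)"
      unfolding power_inverse by (metis inverse_unique mult.commute)
    then have "y $ 2 = inverse ?\<zeta> ^ (n + 1 - j) * x $ 2"
      using j(2) x2 by (simp add: field_simps)
    with True \<open>y $ 1 = 0\<close> show ?thesis by (intro exI[of _ "n + 1 - j"]) simp
  qed
  then obtain j where "y $ 1 = ?\<zeta> ^ j * x $ 1" "y $ 2 = inverse ?\<zeta> ^ j * x $ 2" by blast
  then have "y = (lens_rotation (n + 1) n ^^ j) x"
    unfolding vec_eq_iff forall_2 lens_rotation_funpow_nth by blast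
  then show "a \<in> lens_rel (n + 1) n"
    using x by (auto simp: a lens_rel_def sphere3_def submanifold_def)
qed

theorem theorem1p8:
  fixes n :: nat
  assumes "n \<ge> 1"
  shows "contactomorphic (link_A n) (link_contact_structure n)
           (lens_space (n + 1) n) (lens_contact_structure (n + 1) n)"
proof -
  have cov: "smooth_covering (sphere 0 1) (link_set n) (link_map n) sphere3 (link_A n)
      (lens_rel (n + 1) n) (lens_space (n + 1) n)"
  proof
    show "sphere3 = submanifold (sphere 0 1)" by (rule sphere3_def)
    show "link_A n = submanifold (link_set n)" by (simp add: link_A_def link_set_def)
    show "lens_rel (n + 1) n = {(x, y). x \<in> sphere 0 1 \<and> y \<in> sphere 0 1 \<and> link_map n x = link_map n y}"
      by (rule lens_rel_eq_kernel[OF assms])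
    show "lens_space (n + 1) n = quotient_manifold (lens_rel (n + 1) n) sphere3" by (rule lens_space_def)
    show "link_map n ` sphere 0 1 = link_set n"
      using link_map_in_link_set[OF assms] link_map_surj[OF assms] by blast
    show "smooth_on (sphere 0 1) (link_map n)"
      by (rule smooth_onI[OF smooth_at_link_map[OF assms]])
    fix x :: "complex^2" assume x: "x \<in> sphere 0 1"
    show "charts_at sphere3 x \<noteq> {}"
      unfolding sphere3_def by (rule chart_of_sphere[OF x]) simp
    show "\<exists>V W k. open V \<and> x \<in> V \<and> open W \<and> smooth_on (link_set n \<inter> W) k \<and>
        k ` (link_set n \<inter> W) \<subseteq> sphere 0 1 \<and> (\<forall>z\<in>link_set n \<inter> W. link_map n (k z) = z) \<and>
        (\<forall>y\<in>sphere 0 1 \<inter> V. link_map n y \<in> W \<and> k (link_map n y) = y)"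
      using has_local_inverse[OF assms x] unfolding has_local_inverse_def .
  qed
  \<comment> \<open>The factor has to be a function on the link rather than on the sphere; the
    squared modulus of the first component supplies \<open>p\<close> there.\<close>
  define D where "D = (\<lambda>z :: complex^3. complex_of_real (conformal_factor n ((norm (z $ 1))\<^sup>2)))"
  have conformal: "std_form (link_A n) (link_map n x) (differential sphere3 (link_A n) (link_map n) x v) =
      D (link_map n x) * std_form sphere3 x v"
    if x: "x \<in> sphere 0 1" and v: "v \<in> tangent_space sphere3 x" for x v
    using std_form_differential[OF cov x v smooth_at_imp_differentiable[OF smooth_at_link_map[OF assms x]]]
      std_pairing_link_map[OF assms x] norm_link_map(1)[OF assms x]
    unfolding D_def by metis
  have "D z \<noteq> 0" if z: "z \<in> link_set n" for z
  proof -
    obtain x where x: "x \<in> sphere 0 1" "z = link_map n x"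
      using link_map_surj[OF assms z] by blast
    show ?thesis
      using lens_moduli(2)[OF assms assms x(1) assms x(1) x(1) assms x(1)] norm_link_map(1)[OF assms x(1)] x(2)
      by (simp add: D_def)
  qed
  with smooth_covering.contactomorphic_quotient[where \<alpha> = "std_form (link_A n)" and D = D
      and \<omega> = "std_form sphere3", OF cov conformal]
  have "contactomorphic (link_A n) (form_kernel (link_A n) (std_form (link_A n))) (lens_space (n + 1) n)
      (form_kernel (lens_space (n + 1) n) (induced_form (lens_rel (n + 1) n) sphere3 (std_form sphere3)))"
    by blast
  then show ?thesis
    by (simp add: link_contact_structure_def lens_contact_structure_def lens_contact_form_def)
qed

end
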